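(* In the Herbrand topos $\mathbf{HT}[K_1]$ over Kleene's first partial combinatory algebra $K_1$, the Fan Theorem holds: it is valid in the internal logic that, for every finitely branching tree $T$ and every property $A$ of its nodes that is inherited by successors, if for every infinite path $\alpha$ in $T$ there is $n \in \mathbb N$ with $A(\overline{\alpha}n)$, then there is $n \in \mathbb N$ such that $A(\overline{\alpha}n)$ for all infinite paths $\alpha$ in $T$.
   Context: $K_1$ has underlying set $\mathbb N$, and $n \cdot m$ is the result (if defined) of applying the $n$th partial recursive function to $m$. Write $\mathcal P = K_1$. Fix a standard coding of finite sequences of elements of $\mathcal P$ by elements of $\mathcal P$ (with length, projections, singletons, concatenation etc. computable). For a code $n$, $|n|$ is its length and $n_i$ its $i$th entry. For $A \subseteq \mathcal P$, $!A$ is the set of codes of finite sequences all of whose entries lie in $A$ (including the empty sequence), preordered by: $m \preceq n$ iff for every $i \le |m|$ there is $j \le |n|$ with $m_i = n_j$. A subset $U \subseteq {!A}$ is upwards closed in $!A$ if $m \in U$, $n \in {!A}$, $m \preceq n$ imply $n \in U$. Herbrand topos: $\Sigma = \{(A_0,A_1) : A_0, A_1 \subseteq \mathcal P,\ A_0 \subseteq {!A_1},\ A_0 \text{ upwards closed in } !A_1\}$. For $\phi,\psi : X \to \Sigma$ put $\phi \le \psi$ iff there is $r \in \mathcal P$ such that for all $x \in X$: $n \in {!\phi(x)_1}$ implies $r\cdot n$ is defined and in $!\psi(x)_1$, and $n \in \phi(x)_0$ implies $r\cdot n \in \psi(x)_0$. With reindexing by precomposition, $X \mapsto \Sigma^X$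 is a tripos, and $\mathbf{HT}[\mathcal P]$ is the topos obtained from it by the tripos-to-topos construction; $\mathbb N$ is interpreted as its natural numbers object. A tree is an inhabited and decidable set of finite sequences of natural numbers, closed under predecessors (initial segments). A tree $T$ is finitely branching if $(\forall n \in T)(\exists z\in\mathbb N)(\forall x \in\mathbb N)(n * \langle x\rangle \in T \to x \le z)$, where $*$ is concatenation. An infinite path in $T$ is a function $\alpha:\mathbb N\to\mathbb N$ such that $\overline{\alpha}n = \langle \alpha 0,\dots,\alpha(n-1)\rangle \in T$ for all $n\in\mathbb N$. $A$ is inherited by successors if $A(s)$ and $s*\langle x\rangle\in T$ imply $A(s * \langle x\rangle)$. *)

theory Defs
  imports Main "HOL-Library.Nat_Bijection"
begin

section \<open>Kleene's first partial combinatory algebra\<close>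

text \<open>
  Unary partial recursive functions, presented with pairing: the least class of partial functions
  on the natural numbers that contains the constant zero, the successor and the two projections of
  the Cantor pairing, and is closed under pairing, composition, primitive recursion and
  minimization. Functions of several arguments are functions of one argument on tuples.
\<close>

datatype recfun =
    Zero | Succ | Left | Right
  | Pair recfun recfun | Comp recfun recfun | Prec recfun recfun | Mu recfun

abbreviation npair :: "nat \<Rightarrow> nat \<Rightarrow> nat"
  where "npair a b \<equiv> prod_encode (a, b)"

inductive computes :: "recfun \<Rightarrow> nat \<Rightarrow> nat \<Rightarrow> bool" where
  "computes Zero x 0"
| "computes Succ x (Suc x)"
| "computes Left (npair a b) a"
| "computes Right (npair a b) b"
| "computes f x a \<Longrightarrow> computes g x b \<Longrightarrow> computes (Pair f g) x (npair a b)"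
| "computes g x y \<Longrightarrow> computes f y z \<Longrightarrow> computes (Comp f g) x z"
| "computes f a y \<Longrightarrow> computes (Prec f g) (npair a 0) y"
| "computes (Prec f g) (npair a n) y \<Longrightarrow> computes g (npair a (npair n y)) z \<Longrightarrow>
     computes (Prec f g) (npair a (Suc n)) z"
| "computes f (npair a n) 0 \<Longrightarrow> (\<And>k. k < n \<Longrightarrow> \<exists>v. computes f (npair a k) (Suc v)) \<Longrightarrow>
     computes (Mu f) a n"

inductive_cases computes_elims:
  "computes Zero x y"
  "computes Succ x y"
  "computes Left x y"
  "computes Right x y"
  "computes (Pair f g) x y"
  "computes (Comp f g) x y"
  "computes (Prec f g) x y"
  "computes (Mu f) x y"

lemma computes_deterministic: "computes f x y \<Longrightarrow> computes f x z \<Longrightarrow> y = z"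
proof (induction arbitrary: z rule: computes.induct)
  case (9 f a n)
  from "9.prems" have z: "computes f (npair a z) 0"
      "\<forall>k<z. \<exists>v. computes f (npair a k) (Suc v)"
    by (auto elim: computes_elims(8))
  have "\<not> n < z"
    using z(2) "9.IH"(1) by (metis nat.distinct(1))
  moreover have "\<not> z < n"
    using z(1) "9.IH"(2) by (metis nat.distinct(1))
  ultimately show ?case by simp
next
  case (8 f g a n y z')
  from "8.prems" obtain y' where "computes (Prec f g) (npair a n) y'"
    "computes g (npair a (npair n y')) z"
    by (auto elim: computes_elims(7))
  with "8.IH" show ?case by metis
next
  case (7 f a y g)
  from "7.prems" have "computes f a z" by (auto elim: computes_elims(7))
  with "7.IH" show ?case .
next
  case (6 g x y f z')
  from "6.prems" obtain y' where "computes g x y'" "computes f y' z"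
    by (auto elim: computes_elims(6))
  with "6.IH" show ?case by metis
next
  case (5 f x a g b)
  from "5.prems" obtain a' b' where "computes f x a'" "computes g x b'" "z = npair a' b'"
    by (auto elim: computes_elims(5))
  with "5.IH" show ?case by metis
qed (auto elim: computes_elims(1-4))

lemma prod_decode_less:
  assumes "(t, m) = prod_decode n" "(a, b) = prod_decode m" "0 < t"
  shows "m < n" "a < n" "b < n"
proof -
  have n: "n = npair t m" and m: "m = npair a b"
    using assms by (metis prod_decode_inverse)+
  have "m \<le> triangle (t + m)"
    using \<open>0 < t\<close> by (cases t) simp_all
  then show "m < n"
    using \<open>0 < t\<close> by (simp add: n prod_encode_def)
  then show "a < n" "b < n"
    using le_prod_encode_1[of a b] le_prod_encode_2[of b a] m by simp_all
qed

text \<open>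
  The numbering of the partial recursive functions: an index is a pair consisting of a tag for the
  outermost construction and the (coded) indices of its constituents.
\<close>

function program :: "nat \<Rightarrow> recfun" where
  "program n =
    (let (t, m) = prod_decode n; (a, b) = prod_decode m in
      if t = 0 then Zero
      else if t = 1 then Succ
      else if t = 2 then Left
      else if t = 3 then Right
      else if t = 4 then Pair (program a) (program b)
      else if t = 5 then Comp (program a) (program b)
      else if t = 6 then Prec (program a) (program b)
      else Mu (program m))"
  by pat_completeness auto
termination
  by (relation "Wellfounded.measure id") (auto dest: prod_decode_less)

declare program.simps [simp del]

lemma program_npair:
  "program (npair t (npair a b)) =
    (if t = 0 then Zero
     else if t = 1 then Succ
     else if t = 2 then Left
     else if t = 3 then Right
     else if t = 4 then Pair (program a) (program b)
     else if t = 5 then Comp (program a) (program b)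
     else if t = 6 then Prec (program a) (program b)
     else Mu (program (npair a b)))"
  by (subst program.simps) (simp add: Let_def)

lemma surj_program: "surj program"
proof -
  have "\<exists>n. program n = f" for f
  proof (induction f)
    case Zero
    show ?case by (rule exI[of _ "npair 0 (npair 0 0)"]) (simp add: program_npair)
  next
    case Succ
    show ?case by (rule exI[of _ "npair 1 (npair 0 0)"]) (simp add: program_npair)
  next
    case Left
    show ?case by (rule exI[of _ "npair 2 (npair 0 0)"]) (simp add: program_npair)
  next
    case Right
    show ?case by (rule exI[of _ "npair 3 (npair 0 0)"]) (simp add: program_npair)
  next
    case (Pair f g)
    then obtain a b where "program a = f" "program b = g" by blast
    then show ?case by (intro exI[of _ "npair 4 (npair a b)"]) (simp add: program_npair)
  next
    case (Comp f g)
    then obtain a b where "program a = f" "program b = g" by blast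
    then show ?case by (intro exI[of _ "npair 5 (npair a b)"]) (simp add: program_npair)
  next
    case (Prec f g)
    then obtain a b where "program a = f" "program b = g" by blast
    then show ?case by (intro exI[of _ "npair 6 (npair a b)"]) (simp add: program_npair)
  next
    case (Mu f)
    then obtain a where "program a = f" by blast
    then have "program (npair 7 (npair (fst (prod_decode a)) (snd (prod_decode a)))) = Mu f"
      by (subst program_npair) simp
    then show ?case by blast
  qed
  then show ?thesis by (metis surjI)
qed

definition kapp :: "nat \<Rightarrow> nat \<Rightarrow> nat option"  (infixl "\<bullet>" 70)
  where "n \<bullet> m =
    (if \<exists>k. computes (program n) m k then Some (THE k. computes (program n) m k) else None)"


section \<open>Coded finite sequences\<close>

text \<open>Finite sequences are coded by the bijection \<^const>\<open>list_encode\<close>; the empty one has code 0.\<close>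

definition bang :: "nat set \<Rightarrow> nat set"
  where "bang A = {n. set (list_decode n) \<subseteq> A}"

definition below :: "nat \<Rightarrow> nat \<Rightarrow> bool"  (infix "\<preceq>" 50)
  where "m \<preceq> n \<longleftrightarrow> set (list_decode m) \<subseteq> set (list_decode n)"

definition upclosed_in :: "nat set \<Rightarrow> nat set \<Rightarrow> bool"
  where "upclosed_in B U \<longleftrightarrow> (\<forall>m\<in>U. \<forall>n\<in>B. m \<preceq> n \<longrightarrow> n \<in> U)"

definition bind_code :: "(nat \<Rightarrow> nat) \<Rightarrow> nat \<Rightarrow> nat"
  where "bind_code f n = list_encode (concat (map (\<lambda>k. list_decode (f k)) (list_decode n)))"

text \<open>The subsequence of the entries of the form \<open>npair t a\<close>, with the tag \<open>t\<close> removed.\<close>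

definition untag :: "nat \<Rightarrow> nat \<Rightarrow> nat"
  where "untag t n =
    list_encode (map (snd \<circ> prod_decode) (filter (\<lambda>k. fst (prod_decode k) = t) (list_decode n)))"

lemma untag_mono: "m \<preceq> n \<Longrightarrow> untag t m \<preceq> untag t n"
  by (auto simp: below_def untag_def)

lemma bind_code_mono: "m \<preceq> n \<Longrightarrow> bind_code f m \<preceq> bind_code f n"
  by (auto simp: below_def bind_code_def)


section \<open>The Herbrand tripos\<close>

typedef hprop =
  "{(A0, A1). A0 \<subseteq> bang A1 \<and> upclosed_in (bang A1) A0}"
  by (rule exI[of _ "({}, {})"]) (simp add: upclosed_in_def)

setup_lifting type_definition_hprop

text \<open>The components with index 0 (actual realizers) and 1 (potential realizers).\<close>

lift_definition act :: "hprop \<Rightarrow> nat set" is fst .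

lift_definition pot :: "hprop \<Rightarrow> nat set" is snd .

lemma act_subset: "act p \<subseteq> bang (pot p)"
  by transfer auto

lemma act_up: "m \<in> act p \<Longrightarrow> n \<in> bang (pot p) \<Longrightarrow> m \<preceq> n \<Longrightarrow> n \<in> act p"
  by transfer (auto simp: upclosed_in_def)

definition entails :: "('x \<Rightarrow> hprop) \<Rightarrow> ('x \<Rightarrow> hprop) \<Rightarrow> bool"
  where "entails \<phi> \<psi> \<longleftrightarrow> (\<exists>r. \<forall>x.
      (\<forall>n\<in>bang (pot (\<phi> x)). \<exists>k. r \<bullet> n = Some k \<and> k \<in> bang (pot (\<psi> x))) \<and>
      (\<forall>n\<in>act (\<phi> x). \<exists>k. r \<bullet> n = Some k \<and> k \<in> act (\<psi> x)))"

text \<open>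
  The operations below are the Heyting operations for the preorder \<^const>\<open>entails\<close>, acting
  pointwise, and the adjoints to reindexing along projections; all are determined by
  \<^const>\<open>entails\<close> up to isomorphism.
\<close>

lift_definition htop :: hprop  ("\<^bold>\<top>") is "(UNIV, UNIV)"
  by (simp add: bang_def upclosed_in_def)

lift_definition hbot :: hprop  ("\<^bold>\<bottom>") is "({}, {})"
  by (simp add: upclosed_in_def)

text \<open>
  A sequence of potential realizers of a conjunction or a disjunction amounts to a sequence of
  potential realizers of each of the two components.
\<close>

definition tagged_sum :: "nat set \<Rightarrow> nat set \<Rightarrow> nat set"
  where "tagged_sum A B = npair 0 ` A \<union> npair 1 ` B"

lemma untag_bang:
  assumes "n \<in> bang (tagged_sum A B)"
  shows "untag 0 n \<in> bang A" "untag 1 n \<in> bang B"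
  using assms by (auto simp: bang_def tagged_sum_def untag_def)

lemma upclosed_untag:
  "upclosed_in (bang A) U \<Longrightarrow> upclosed_in (bang (tagged_sum A B)) {n \<in> bang (tagged_sum A B). untag 0 n \<in> U}"
  "upclosed_in (bang B) U \<Longrightarrow> upclosed_in (bang (tagged_sum A B)) {n \<in> bang (tagged_sum A B). untag 1 n \<in> U}"
  unfolding upclosed_in_def using untag_mono untag_bang[of _ A B] by blast+

lemma upclosed_Collect:
  assumes "upclosed_in X {n \<in> X. P n}" "upclosed_in X {n \<in> X. Q n}"
  shows "upclosed_in X {n \<in> X. P n \<and> Q n}" "upclosed_in X {n \<in> X. P n \<or> Q n}"
  using assms unfolding upclosed_in_def by blast+

lift_definition hconj :: "hprop \<Rightarrow> hprop \<Rightarrow> hprop"  (infixr "\<^bold>\<and>" 35)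
  is "\<lambda>(A0, A1) (B0, B1).
    ({n \<in> bang (tagged_sum A1 B1). untag 0 n \<in> A0 \<and> untag 1 n \<in> B0}, tagged_sum A1 B1)"
  by (clarsimp simp del: One_nat_def simp: upclosed_untag upclosed_Collect)

lift_definition hdisj :: "hprop \<Rightarrow> hprop \<Rightarrow> hprop"  (infixr "\<^bold>\<or>" 30)
  is "\<lambda>(A0, A1) (B0, B1).
    ({n \<in> bang (tagged_sum A1 B1). untag 0 n \<in> A0 \<or> untag 1 n \<in> B0}, tagged_sum A1 B1)"
  by (clarsimp simp del: One_nat_def simp: upclosed_untag upclosed_Collect)

text \<open>
  A realizer of an implication is a sequence of functions on sequences of potential realizers; it
  is applied to an argument by concatenating the values of all its entries.
\<close>

definition imp_pot :: "nat set \<Rightarrow> nat set \<Rightarrow> nat set"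
  where "imp_pot A1 B1 = {r. \<forall>m\<in>bang A1. \<exists>k. r \<bullet> m = Some k \<and> k \<in> bang B1}"

lemma bind_imp_bang:
  assumes "n \<in> bang (imp_pot A B)" "m \<in> bang A"
  shows "bind_code (\<lambda>r. the (r \<bullet> m)) n \<in> bang B"
proof -
  have "set (list_decode (the (r \<bullet> m))) \<subseteq> B" if "r \<in> set (list_decode n)" for r
    using that assms unfolding bang_def imp_pot_def by fastforce
  then show ?thesis by (auto simp: bang_def bind_code_def)
qed

lemma upclosed_bind:
  assumes "upclosed_in (bang B) U" "V \<subseteq> bang A"
  shows "upclosed_in (bang (imp_pot A B))
    {n \<in> bang (imp_pot A B). \<forall>a\<in>V. bind_code (\<lambda>r. the (r \<bullet> a)) n \<in> U}"
proof -
  have "bind_code (\<lambda>r. the (r \<bullet> a)) n \<in> U"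
    if "bind_code (\<lambda>r. the (r \<bullet> a)) m \<in> U" "n \<in> bang (imp_pot A B)" "m \<preceq> n" "a \<in> V" for a m n
    using assms that bind_code_mono[of m n] bind_imp_bang[of n A B a]
    unfolding upclosed_in_def by blast
  then show ?thesis
    unfolding upclosed_in_def by blast
qed

lift_definition himp :: "hprop \<Rightarrow> hprop \<Rightarrow> hprop"  (infixr "\<^bold>\<longrightarrow>" 25)
  is "\<lambda>(A0, A1) (B0, B1).
    ({n \<in> bang (imp_pot A1 B1). \<forall>m\<in>A0. bind_code (\<lambda>r. the (r \<bullet> m)) n \<in> B0}, imp_pot A1 B1)"
  by (clarsimp simp: upclosed_bind)

lemma upclosed_Inter:
  assumes "\<And>x. A0 x \<subseteq> bang (A1 x)" "\<And>x. upclosed_in (bang (A1 x)) (A0 x)"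
  shows "(\<Inter>x. A0 x) \<subseteq> bang (\<Inter>x. A1 x)" "upclosed_in (bang (\<Inter>x. A1 x)) (\<Inter>x. A0 x)"
proof -
  have *: "bang (\<Inter>x. A1 x) = (\<Inter>x. bang (A1 x))"
    by (auto simp: bang_def)
  show "(\<Inter>x. A0 x) \<subseteq> bang (\<Inter>x. A1 x)"
    unfolding * using assms(1) by blast
  show "upclosed_in (bang (\<Inter>x. A1 x)) (\<Inter>x. A0 x)"
    unfolding * using assms(2) unfolding upclosed_in_def by blast
qed

lemma upclosed_Ex:
  "upclosed_in B {n \<in> B. \<exists>x. \<exists>m\<in>set (list_decode n). P x m}"
  unfolding upclosed_in_def below_def by blast

lift_definition hall :: "('x \<Rightarrow> hprop) \<Rightarrow> hprop"  (binder "\<^bold>\<forall>" 10)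
  is "\<lambda>\<phi>. (\<Inter>x. fst (\<phi> x), \<Inter>x. snd (\<phi> x))"
  subgoal for \<phi>
    using upclosed_Inter[of "\<lambda>x. fst (\<phi> x)" "\<lambda>x. snd (\<phi> x)"] by (simp add: split_beta)
  done

text \<open>
  A potential realizer of an existential statement is a sequence of potential realizers of a single
  instance; realizers are sequences of these, since there need be no uniform way of treating
  sequences whose entries belong to different instances.
\<close>

lift_definition hex :: "('x \<Rightarrow> hprop) \<Rightarrow> hprop"  (binder "\<^bold>\<exists>" 10)
  is "\<lambda>\<phi>. ({n \<in> bang (\<Union>x. bang (snd (\<phi> x))). \<exists>x. \<exists>m\<in>set (list_decode n). m \<in> fst (\<phi> x)},
    \<Union>x. bang (snd (\<phi> x)))"
  by (simp add: upclosed_Ex)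

abbreviation hnot :: "hprop \<Rightarrow> hprop"  ("\<^bold>\<not> _" [40] 40)
  where "\<^bold>\<not> p \<equiv> p \<^bold>\<longrightarrow> \<^bold>\<bottom>"

abbreviation hiff :: "hprop \<Rightarrow> hprop \<Rightarrow> hprop"  (infixr "\<^bold>\<longleftrightarrow>" 25)
  where "p \<^bold>\<longleftrightarrow> q \<equiv> (p \<^bold>\<longrightarrow> q) \<^bold>\<and> (q \<^bold>\<longrightarrow> p)"

definition holds :: "hprop \<Rightarrow> bool"
  where "holds p \<longleftrightarrow> entails (\<lambda>_ :: unit. \<^bold>\<top>) (\<lambda>_. p)"


section \<open>The internal logic of the Herbrand topos\<close>

text \<open>
  In the topos obtained from a tripos, an object is a set with a tripos-valued partial equivalence
  relation \<open>X\<close>; here the set is a type. A formula of the internal logic is interpreted in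
  the tripos, with equality on \<open>X\<close> read as \<open>X\<close> and with quantifiers over \<open>X\<close> relativised
  to its existence predicate \<open>X x x\<close>. A sentence denotes a subobject of the terminal object,
  which is everything iff its truth value \<^const>\<open>holds\<close>.
\<close>

type_synonym 'a obj = "'a \<Rightarrow> 'a \<Rightarrow> hprop"

abbreviation (input) obj_eq :: "'a \<Rightarrow> 'a obj \<Rightarrow> 'a \<Rightarrow> hprop"  ("_ \<^bold>=\<^bsub>_\<^esub> _" [51, 0, 51] 50)
  where "x \<^bold>=\<^bsub>X\<^esub> y \<equiv> X x y"

abbreviation (input) exists_in :: "'a obj \<Rightarrow> 'a \<Rightarrow> hprop"
  where "exists_in X x \<equiv> x \<^bold>=\<^bsub>X\<^esub> x"

definition All_in :: "'a obj \<Rightarrow> ('a \<Rightarrow> hprop) \<Rightarrow> hprop"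
  where "All_in X \<phi> = (\<^bold>\<forall>x. exists_in X x \<^bold>\<longrightarrow> \<phi> x)"

definition Ex_in :: "'a obj \<Rightarrow> ('a \<Rightarrow> hprop) \<Rightarrow> hprop"
  where "Ex_in X \<phi> = (\<^bold>\<exists>x. exists_in X x \<^bold>\<and> \<phi> x)"

syntax
  "_All_in" :: "pttrn \<Rightarrow> 'a obj \<Rightarrow> hprop \<Rightarrow> hprop"  ("(3\<^bold>\<forall>_\<^bold>\<in>_./ _)" [0, 0, 10] 10)
  "_Ex_in" :: "pttrn \<Rightarrow> 'a obj \<Rightarrow> hprop \<Rightarrow> hprop"  ("(3\<^bold>\<exists>_\<^bold>\<in>_./ _)" [0, 0, 10] 10)
translations
  "\<^bold>\<forall>x\<^bold>\<in>X. p" \<rightleftharpoons> "CONST All_in X (\<lambda>x. p)"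
  "\<^bold>\<exists>x\<^bold>\<in>X. p" \<rightleftharpoons> "CONST Ex_in X (\<lambda>x. p)"

text \<open>
  The power object: an element is a strict and extensional predicate. Membership of \<open>x\<close> in
  \<open>R\<close> is \<open>R x\<close>; whenever it is used, \<open>R\<close> is bounded by a quantifier over the power object.
\<close>

definition strict_ext :: "'a obj \<Rightarrow> ('a \<Rightarrow> hprop) \<Rightarrow> hprop"
  where "strict_ext X R =
    ((\<^bold>\<forall>x. R x \<^bold>\<longrightarrow> exists_in X x) \<^bold>\<and> (\<^bold>\<forall>x y. R x \<^bold>\<and> x \<^bold>=\<^bsub>X\<^esub> y \<^bold>\<longrightarrow> R y))"

definition pow_obj :: "'a obj \<Rightarrow> ('a \<Rightarrow> hprop) obj"
  where "pow_obj X R S = (strict_ext X R \<^bold>\<and> strict_ext X S \<^bold>\<and> (\<^bold>\<forall>x. R x \<^bold>\<longleftrightarrow> S x))"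

text \<open>
  The exponential \<open>Y\<^sup>X\<close>: an element is a functional relation, and \<open>F x y\<close> expresses
  that the value of \<open>F\<close> at \<open>x\<close> is \<open>y\<close>.
\<close>

definition functional :: "'a obj \<Rightarrow> 'b obj \<Rightarrow> ('a \<Rightarrow> 'b \<Rightarrow> hprop) \<Rightarrow> hprop"
  where "functional X Y F =
    ((\<^bold>\<forall>x y. F x y \<^bold>\<longrightarrow> exists_in X x \<^bold>\<and> exists_in Y y) \<^bold>\<and>
     (\<^bold>\<forall>x y x' y'. F x y \<^bold>\<and> x \<^bold>=\<^bsub>X\<^esub> x' \<^bold>\<and> y \<^bold>=\<^bsub>Y\<^esub> y' \<^bold>\<longrightarrow> F x' y') \<^bold>\<and>
     (\<^bold>\<forall>x y y'. F x y \<^bold>\<and> F x y' \<^bold>\<longrightarrow> y \<^bold>=\<^bsub>Y\<^esub> y') \<^bold>\<and>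
     (\<^bold>\<forall>x. exists_in X x \<^bold>\<longrightarrow> (\<^bold>\<exists>y. F x y)))"

definition exp_obj :: "'a obj \<Rightarrow> 'b obj \<Rightarrow> ('a \<Rightarrow> 'b \<Rightarrow> hprop) obj"
  where "exp_obj X Y F G =
    (functional X Y F \<^bold>\<and> functional X Y G \<^bold>\<and> (\<^bold>\<forall>x y. F x y \<^bold>\<longleftrightarrow> G x y))"

text \<open>
  The natural numbers object: the only potential realizer of the existence of \<open>n\<close> is \<open>n\<close>
  itself, and the actual realizers are the nonempty sequences of potential ones. Zero and successor
  are represented by the functions \<open>0\<close> and \<^const>\<open>Suc\<close>. They satisfy the Peano axioms
  internally: the induction axiom is realized by iterating a realizer of the induction step \<open>n\<close>
  times if the given sequence of copies of \<open>n\<close> is nonempty, and by the empty sequence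
  otherwise. The object of finite sequences of natural numbers is represented in the same way
  through codes of sequences. Total computable functions on the carriers, such as addition,
  length and concatenation, represent the corresponding internal functions.
\<close>

lift_definition is_code :: "nat \<Rightarrow> hprop" is "\<lambda>k. ({n \<in> bang {k}. list_decode n \<noteq> []}, {k})"
  by (auto simp: upclosed_in_def below_def)

definition coded_obj :: "('a \<Rightarrow> nat) \<Rightarrow> 'a obj"
  where "coded_obj c x y = (if x = y then is_code (c x) else \<^bold>\<bottom>)"

definition nat_obj :: "nat obj"  ("\<^bold>N")
  where "\<^bold>N = coded_obj (\<lambda>n. n)"

definition seq_obj :: "nat list obj"  ("\<^bold>S")
  where "\<^bold>S = coded_obj list_encode"


section \<open>Trees and paths in the internal logic\<close>

definition le_nat :: "nat \<Rightarrow> nat \<Rightarrow> hprop"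
  where "le_nat m n = (\<^bold>\<exists>k\<^bold>\<in>\<^bold>N. m + k \<^bold>=\<^bsub>\<^bold>N\<^esub> n)"

definition tree :: "(nat list \<Rightarrow> hprop) \<Rightarrow> hprop"
  where "tree T =
    ((\<^bold>\<exists>s\<^bold>\<in>\<^bold>S. T s) \<^bold>\<and>
     (\<^bold>\<forall>s\<^bold>\<in>\<^bold>S. T s \<^bold>\<or> \<^bold>\<not> T s) \<^bold>\<and>
     (\<^bold>\<forall>s\<^bold>\<in>\<^bold>S. \<^bold>\<forall>t\<^bold>\<in>\<^bold>S. T (s @ t) \<^bold>\<longrightarrow> T s))"

definition finitely_branching :: "(nat list \<Rightarrow> hprop) \<Rightarrow> hprop"
  where "finitely_branching T =
    (\<^bold>\<forall>s\<^bold>\<in>\<^bold>S. T s \<^bold>\<longrightarrow> (\<^bold>\<exists>z\<^bold>\<in>\<^bold>N. \<^bold>\<forall>x\<^bold>\<in>\<^bold>N. T (s @ [x]) \<^bold>\<longrightarrow> le_nat x z))"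

definition inherited :: "(nat list \<Rightarrow> hprop) \<Rightarrow> (nat list \<Rightarrow> hprop) \<Rightarrow> hprop"
  where "inherited T A = (\<^bold>\<forall>s\<^bold>\<in>\<^bold>S. \<^bold>\<forall>x\<^bold>\<in>\<^bold>N. A s \<^bold>\<and> T (s @ [x]) \<^bold>\<longrightarrow> A (s @ [x]))"

text \<open>The entry at position \<open>i\<close>, made total (and computable) by a default value.\<close>

definition entry :: "nat list \<Rightarrow> nat \<Rightarrow> nat"
  where "entry s i = (if i < length s then s ! i else 0)"

text \<open>
  The graph of the operation taking \<open>\<alpha>\<close> and \<open>n\<close> to the sequence of the first \<open>n\<close>
  values of \<open>\<alpha>\<close>.
\<close>

definition is_initial_segment :: "(nat \<Rightarrow> nat \<Rightarrow> hprop) \<Rightarrow> nat \<Rightarrow> nat list \<Rightarrow> hprop"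
  where "is_initial_segment \<alpha> n s =
    (length s \<^bold>=\<^bsub>\<^bold>N\<^esub> n \<^bold>\<and> (\<^bold>\<forall>i\<^bold>\<in>\<^bold>N. le_nat (Suc i) n \<^bold>\<longrightarrow> \<alpha> i (entry s i)))"

text \<open>\<open>A\<close> holds of the sequence of the first \<open>n\<close> values of \<open>\<alpha>\<close>.\<close>

definition at_segment :: "(nat list \<Rightarrow> hprop) \<Rightarrow> (nat \<Rightarrow> nat \<Rightarrow> hprop) \<Rightarrow> nat \<Rightarrow> hprop"
  where "at_segment A \<alpha> n = (\<^bold>\<exists>s\<^bold>\<in>\<^bold>S. is_initial_segment \<alpha> n s \<^bold>\<and> A s)"

definition infinite_path :: "(nat list \<Rightarrow> hprop) \<Rightarrow> (nat \<Rightarrow> nat \<Rightarrow> hprop) \<Rightarrow> hprop"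
  where "infinite_path T \<alpha> = (\<^bold>\<forall>n\<^bold>\<in>\<^bold>N. at_segment T \<alpha> n)"

end

theory Submission
  imports Defs
begin

text \<open>
  Realizers of existential statements are finite lists of candidates. From the branching bounds of
  the tree one computes, for every length, a finite list of sequences that contains all the nodes
  of that length. Hence all the infinite paths of the tree that exist classically exist internally,
  and they do so with one and the same realizer. Applied to this realizer, the realizer of the bar
  hypothesis returns a finite list of candidates \<open>n\<close> that works for every path. A number above all
  of them is a uniform bound: realizers of \<open>A\<close> at the initial segments found in this way are
  extended along the tree, since \<open>A\<close> is inherited by successors. Conversely an internal path
  determines a classical one, so every initial segment of an internal path is covered.
\<close>

section \<open>Uniform computability\<close>

text \<open>In ordinary recursive realizability the theorem fails: Kleene's infinite computable
  binary tree has no computable path, so lying outside it bars every computable path of the full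
  binary tree without a uniform bound. Here a non-computable path can exist internally, because
  wrong candidates may stand beside a right one and a bound on the values of the path is computable
  even if the values are not. The obstacle is the demand on potential realizers. A program sees
  numbers only, never \<open>T\<close>, \<open>A\<close> or the path, and a realizer of an
  implication must converge on every potential realizer, however meaningless. So no node may be
  filtered by membership in the tree: decidability of \<open>T\<close> yields two lists of
  candidates, and it is not known which is right. Truth enters the verification alone. This is why
  computability is relative to a domain on which all applications converge, with formulas as ghost
  parameters, and why \<open>realizes\<close> treats the potential and the actual case together. No
  maximum over candidates is computed: the code of a list dominates its entries, so codes themselves
  serve as bounds.\<close>

text \<open>
  The program is given only \<open>e z\<close>. The parameter \<open>z\<close> may contain arbitrary
  further data, such as the formulas that the given numbers realize.
\<close>

definition computable_on :: "'z set \<Rightarrow> ('z \<Rightarrow> nat) \<Rightarrow> ('z \<Rightarrow> nat) \<Rightarrow> bool"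
  where "computable_on D e f \<longleftrightarrow> (\<exists>c. \<forall>z\<in>D. computes c (e z) (f z))"

section \<open>Pairing, substitution, recursion and minimization\<close>

definition pfst :: "nat \<Rightarrow> nat" where "pfst n = fst (prod_decode n)"
definition psnd :: "nat \<Rightarrow> nat" where "psnd n = snd (prod_decode n)"

lemma pfst_prod_encode [simp]: "pfst (prod_encode p) = fst p"
  and psnd_prod_encode [simp]: "psnd (prod_encode p) = snd p"
  and npair_collapse [simp]: "npair (pfst n) (psnd n) = n"
  by (simp_all add: pfst_def psnd_def)

lemma computable_on_cong:
  "computable_on D e f \<Longrightarrow> (\<And>z. z \<in> D \<Longrightarrow> f z = g z) \<Longrightarrow> computable_on D e g"
  by (auto simp: computable_on_def)

lemma computable_on_self: "computable_on D e e"
proof -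
  have "computes (Pair Left Right) x x" for x
    using computes.intros(5)[OF computes.intros(3,4), of "pfst x" "psnd x"] by simp
  then show ?thesis unfolding computable_on_def by blast
qed

lemma computable_on_trans:
  assumes "computable_on D e f" "computable_on D f g"
  shows "computable_on D e g"
proof -
  obtain c d where "\<forall>z\<in>D. computes c (e z) (f z)" "\<forall>z\<in>D. computes d (f z) (g z)"
    using assms unfolding computable_on_def by blast
  then have "\<forall>z\<in>D. computes (Comp d c) (e z) (g z)"
    by (blast intro: computes.intros(6))
  then show ?thesis unfolding computable_on_def by blast
qed

text \<open>Substitution: \<open>F\<close> is treated once, in parameters of its own, and is then
  available wherever its encoded argument is computable and lies in the domain. Partial operations
  such as application enter in this way.\<close>

lemma computable_on_comp:
  assumes "computable_on D' e' F" "computable_on D e (\<lambda>z. e' (p z))" "\<And>z. z \<in> D \<Longrightarrow> p z \<in> D'"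
  shows "computable_on D e (\<lambda>z. F (p z))"
proof -
  have "computable_on D (\<lambda>z. e' (p z)) (\<lambda>z. F (p z))"
    using assms(1,3) unfolding computable_on_def by blast
  then show ?thesis
    by (rule computable_on_trans[OF assms(2)])
qed

lemma computable_on_Suc:
  assumes "computable_on D e f"
  shows "computable_on D e (\<lambda>z. Suc (f z))"
proof -
  have "computable_on D f (\<lambda>z. Suc (f z))"
    unfolding computable_on_def by (blast intro: computes.intros(2))
  then show ?thesis
    by (rule computable_on_trans[OF assms])
qed

lemma computable_on_const: "computable_on D e (\<lambda>_. k)"
proof (induction k)
  case 0
  show ?case unfolding computable_on_def by (blast intro: computes.intros(1))
next
  case (Suc k)
  then show ?case by (rule computable_on_Suc)
qed

lemma computable_on_pfst:
  assumes "computable_on D e f"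
  shows "computable_on D e (\<lambda>z. pfst (f z))"
proof -
  have "computable_on D f (\<lambda>z. pfst (f z))"
    unfolding computable_on_def using computes.intros(3) by (metis npair_collapse)
  then show ?thesis
    by (rule computable_on_trans[OF assms])
qed

lemma computable_on_psnd:
  assumes "computable_on D e f"
  shows "computable_on D e (\<lambda>z. psnd (f z))"
proof -
  have "computable_on D f (\<lambda>z. psnd (f z))"
    unfolding computable_on_def using computes.intros(4) by (metis npair_collapse)
  then show ?thesis
    by (rule computable_on_trans[OF assms])
qed

lemma computable_on_npair:
  assumes "computable_on D e f" "computable_on D e g"
  shows "computable_on D e (\<lambda>z. npair (f z) (g z))"
proof -
  obtain c d where "\<forall>z\<in>D. computes c (e z) (f z)" "\<forall>z\<in>D. computes d (e z) (g z)"
    using assms unfolding computable_on_def by blast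
  then have "\<forall>z\<in>D. computes (Pair c d) (e z) (npair (f z) (g z))"
    by (blast intro: computes.intros(5))
  then show ?thesis unfolding computable_on_def by blast
qed

text \<open>The step has to be computable only at the states \<open>R z i\<close> that the recursion
  really passes through. A step that diverges elsewhere is allowed, so invariants of the recursion
  can guarantee convergence.\<close>

lemma computable_on_rec:
  assumes "computable_on D e n" "computable_on D e (\<lambda>z. R z 0)"
    and "computable_on {(z, i). z \<in> D \<and> i < n z} (\<lambda>(z, i). npair (e z) (npair i (R z i)))
      (\<lambda>(z, i). R z (Suc i))"
  shows "computable_on D e (\<lambda>z. R z (n z))"
proof -
  obtain c d where c: "\<forall>z\<in>D. computes c (e z) (R z 0)"
    and d: "\<And>z i. z \<in> D \<Longrightarrow> i < n z \<Longrightarrow> computes d (npair (e z) (npair i (R z i))) (R z (Suc i))"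
    using assms(2,3) unfolding computable_on_def by fastforce
  have "computes (Prec c d) (npair (e z) i) (R z i)" if "z \<in> D" "i \<le> n z" for z i
    using that(2)
  proof (induction i)
    case 0
    then show ?case using c that(1) by (blast intro: computes.intros(7))
  next
    case (Suc i)
    then show ?case using d[OF that(1), of i] by (auto intro: computes.intros(8))
  qed
  then have "computable_on D (\<lambda>z. npair (e z) (n z)) (\<lambda>z. R z (n z))"
    unfolding computable_on_def by blast
  then show ?thesis
    by (rule computable_on_trans[OF computable_on_npair[OF computable_on_self assms(1)]])
qed

lemma computable_on_Least:
  assumes "computable_on {(z, i). z \<in> D \<and> i \<le> n z} (\<lambda>(z, i). npair (e z) i) (\<lambda>(z, i). F z i)"
    and "\<And>z. z \<in> D \<Longrightarrow> F z (n z) = 0" "\<And>z i. z \<in> D \<Longrightarrow> i < n z \<Longrightarrow> F z i \<noteq> 0"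
  shows "computable_on D e n"
proof -
  obtain c where c: "\<And>z i. z \<in> D \<Longrightarrow> i \<le> n z \<Longrightarrow> computes c (npair (e z) i) (F z i)"
    using assms(1) unfolding computable_on_def by fastforce
  have "computes (Mu c) (e z) (n z)" if "z \<in> D" for z
  proof (rule computes.intros(9))
    show "computes c (npair (e z) (n z)) 0"
      using c[OF that, of "n z"] assms(2)[OF that] by simp
    show "\<exists>v. computes c (npair (e z) k) (Suc v)" if "k < n z" for k
      using c[OF \<open>z \<in> D\<close>, of k] assms(3)[OF \<open>z \<in> D\<close> that] that
      by (metis less_imp_le_nat not0_implies_Suc)
  qed
  then show ?thesis unfolding computable_on_def by blast
qed

text \<open>Entering the scope of a bound variable: the old encoding becomes the left half of the
  new one, so whatever was computable from the outer parameters remains so inside a fold, a bind or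
  a closure.\<close>

lemma computable_on_weaken:
  assumes "computable_on D e f" "\<And>p. p \<in> D' \<Longrightarrow> fst p \<in> D"
  shows "computable_on D' (\<lambda>(z, x). npair (e z) (w z x)) (\<lambda>p. f (fst p))"
proof -
  have "computable_on D' (\<lambda>(z, x). npair (e z) (w z x)) (\<lambda>p. pfst ((\<lambda>(z, x). npair (e z) (w z x)) p))"
    by (intro computable_on_pfst computable_on_self)
  then have "computable_on D' (\<lambda>(z, x). npair (e z) (w z x)) (\<lambda>p. e (fst p))"
    by (rule computable_on_cong) auto
  then show ?thesis
    by (rule computable_on_comp[OF assms(1)]) (rule assms(2))
qed

lemma computable_on_new:
  "computable_on D' (\<lambda>(z, x). npair (e z) (w z x)) (\<lambda>p. w (fst p) (snd p))"
proof -
  have "computable_on D' (\<lambda>(z, x). npair (e z) (w z x)) (\<lambda>p. psnd ((\<lambda>(z, x). npair (e z) (w z x)) p))"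
    by (intro computable_on_psnd computable_on_self)
  then show ?thesis
    by (rule computable_on_cong) auto
qed

lemma computable_on_context_snd:
  "computable_on D (\<lambda>(z, x). npair (e z) x) snd"
  using computable_on_new[of D e "\<lambda>_ x. x"] by simp

lemma computable_on_weaken2:
  assumes "computable_on D e f" "\<And>p. p \<in> D' \<Longrightarrow> fst p \<in> D"
  shows "computable_on D' (\<lambda>(z, i, y). npair (e z) (w z i y)) (\<lambda>p. f (fst p))"
  using computable_on_weaken[OF assms, where w="\<lambda>z (i, y). w z i y"] by (simp add: case_prod_unfold)

lemma computable_on_context_mid:
  "computable_on D (\<lambda>(z, i, y). npair (e z) (npair i y)) (\<lambda>p. fst (snd p))"
  by (rule computable_on_cong[OF computable_on_pfst[OF computable_on_psnd[OF computable_on_self]]]) auto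

lemma computable_on_context_last:
  "computable_on D (\<lambda>(z, i, y). npair (e z) (npair i y)) (\<lambda>p. snd (snd p))"
  by (rule computable_on_cong[OF computable_on_psnd[OF computable_on_psnd[OF computable_on_self]]]) auto

lemma computable_on_context_fst: "computable_on D (\<lambda>(x, y). npair x y) fst"
  by (rule computable_on_cong[OF computable_on_pfst[OF computable_on_self]]) auto

lemmas computable_on_context_snd' =
  computable_on_weaken[OF computable_on_context_snd[where D=UNIV], OF UNIV_I]

section \<open>Total recursion, arithmetic and case distinction\<close>

lemma computable_on_rec':
  assumes "computable_on D e n" "computable_on D e a"
    and "computable_on {(z, i, y). z \<in> D} (\<lambda>(z, i, y). npair (e z) (npair i y))
      (\<lambda>(z, i, y). F z i y)"
  shows "computable_on D e (\<lambda>z. rec_nat (a z) (F z) (n z))"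
proof (rule computable_on_rec[OF assms(1)])
  show "computable_on D e (\<lambda>z. rec_nat (a z) (F z) 0)"
    using assms(2) by simp
  have "computable_on {(z, i). z \<in> D \<and> i < n z} (\<lambda>(z, i). npair (e z) (npair i (rec_nat (a z) (F z) i)))
    (\<lambda>p. (\<lambda>(z, i, y). F z i y) ((\<lambda>(z, i). (z, i, rec_nat (a z) (F z) i)) p))"
    by (rule computable_on_comp[OF assms(3)], rule computable_on_cong, rule computable_on_self)
      (auto split: prod.splits)
  then show "computable_on {(z, i). z \<in> D \<and> i < n z} (\<lambda>(z, i). npair (e z) (npair i (rec_nat (a z) (F z) i)))
     (\<lambda>(z, i). rec_nat (a z) (F z) (Suc i))"
    by (rule computable_on_cong) auto
qed

lemma computable_on_pred:
  assumes "computable_on D e f"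
  shows "computable_on D e (\<lambda>z. f z - 1)"
proof -
  have "computable_on D e (\<lambda>z. rec_nat 0 (\<lambda>i y. i) (f z))"
  proof (rule computable_on_rec'[OF assms computable_on_const])
    show "computable_on {(z, i, y). z \<in> D} (\<lambda>(z, i, y). npair (e z) (npair i y)) (\<lambda>(z, i, y). i)"
      by (rule computable_on_cong[OF computable_on_pfst[OF computable_on_psnd[OF computable_on_self]]]) auto
  qed
  moreover have "rec_nat 0 (\<lambda>i y. i) n = n - 1" for n :: nat
    by (cases n) auto
  ultimately show ?thesis by simp
qed

lemma computable_on_diff:
  assumes "computable_on D e f" "computable_on D e g"
  shows "computable_on D e (\<lambda>z. f z - g z)"
proof -
  have "computable_on D e (\<lambda>z. rec_nat (f z) (\<lambda>i y. y - 1) (g z))"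
  proof (rule computable_on_rec'[OF assms(2,1)])
    show "computable_on {(z, i, y). z \<in> D} (\<lambda>(z, i, y). npair (e z) (npair i y)) (\<lambda>(z, i, y). y - 1)"
      by (rule computable_on_cong[OF computable_on_pred[OF computable_on_psnd[OF computable_on_psnd[OF computable_on_self]]]]) auto
  qed
  moreover have "rec_nat m (\<lambda>i y. y - 1) n = m - n" for m n :: nat
    by (induction n) auto
  ultimately show ?thesis by simp
qed

lemma computable_on_if_zero:
  assumes "computable_on D e f" "computable_on D e a" "computable_on D e b"
  shows "computable_on D e (\<lambda>z. if f z = 0 then a z else b z)"
proof -
  have "computable_on D e (\<lambda>z. rec_nat (a z) (\<lambda>i y. b z) (f z))"
  proof (rule computable_on_rec'[OF assms(1,2)])
    show "computable_on {(z, i, y). z \<in> D} (\<lambda>(z, i, y). npair (e z) (npair i y)) (\<lambda>(z, i, y). b z)"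
      using computable_on_weaken[OF assms(3), of "{(z, i, y). z \<in> D}" "\<lambda>z (i, y). npair i y"]
      by (auto simp: case_prod_unfold)
  qed
  moreover have "rec_nat (a z) (\<lambda>i y. b z) n = (if n = 0 then a z else b z)" for z n
    by (cases n) auto
  ultimately show ?thesis by simp
qed

lemma computable_on_if_eq:
  assumes "computable_on D e f" "computable_on D e g" "computable_on D e a" "computable_on D e b"
  shows "computable_on D e (\<lambda>z. if f z = g z then a z else b z)"
proof -
  have "computable_on D e (\<lambda>z. if f z - g z = 0 then if g z - f z = 0 then a z else b z else b z)"
    by (intro computable_on_if_zero computable_on_diff assms)
  then show ?thesis
    by (rule computable_on_cong) auto
qed

lemmas computable_on_intros =
  computable_on_const computable_on_Suc computable_on_npair computable_on_pfst computable_on_psnd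
  computable_on_if_zero computable_on_if_eq


section \<open>Computing with coded sequences\<close>

definition cons :: "nat \<Rightarrow> nat \<Rightarrow> nat" where "cons x n = Suc (npair x n)"
definition hd_code :: "nat \<Rightarrow> nat" where "hd_code n = pfst (n - 1)"
definition tl_code :: "nat \<Rightarrow> nat" where "tl_code n = psnd (n - 1)"

lemma list_decode_cons [simp]: "list_decode (cons x n) = x # list_decode n"
  by (simp add: cons_def)

lemma hd_code_cons [simp]: "hd_code (cons x n) = x"
  and tl_code_cons [simp]: "tl_code (cons x n) = n"
  by (simp_all add: cons_def hd_code_def tl_code_def)

lemma list_encode_Cons: "list_encode (x # xs) = cons x (list_encode xs)"
  by (simp add: cons_def)

lemma cons_neq_0 [simp]: "cons x n \<noteq> 0"
  by (simp add: cons_def)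

text \<open>On the empty sequence, whose code is 0, truncated subtraction leaves 0, and 0 decodes to
  the pair \<open>(0, 0)\<close>. Hence its tail is again empty, and its head is the default value
  used by \<open>entry\<close>.\<close>

lemma tl_code_encode: "tl_code (list_encode xs) = list_encode (tl xs)"
proof (cases xs)
  case Nil
  have "prod_decode 0 = (0, 0)"
    by (simp add: prod_decode_def prod_decode_aux.simps)
  then show ?thesis by (simp add: Nil tl_code_def psnd_def)
qed (simp add: list_encode_Cons del: list_encode.simps(2))

lemma hd_code_encode: "hd_code (list_encode xs) = entry xs 0"
proof (cases xs)
  case Nil
  have "prod_decode 0 = (0, 0)"
    by (simp add: prod_decode_def prod_decode_aux.simps)
  then show ?thesis by (simp add: Nil hd_code_def pfst_def entry_def)
qed (simp add: list_encode_Cons entry_def del: list_encode.simps(2))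

lemma computable_on_cons:
  "computable_on D e f \<Longrightarrow> computable_on D e g \<Longrightarrow> computable_on D e (\<lambda>z. cons (f z) (g z))"
  unfolding cons_def by (intro computable_on_intros)

lemma computable_on_hd_code:
  "computable_on D e f \<Longrightarrow> computable_on D e (\<lambda>z. hd_code (f z))"
  unfolding hd_code_def by (intro computable_on_pfst computable_on_pred)

lemma computable_on_tl_code:
  "computable_on D e f \<Longrightarrow> computable_on D e (\<lambda>z. tl_code (f z))"
  unfolding tl_code_def by (intro computable_on_psnd computable_on_pred)

lemma list_encode_drop_Suc: "list_encode (drop (Suc i) xs) = tl_code (list_encode (drop i xs))"
  by (simp add: tl_code_encode drop_Suc tl_drop)

lemma length_le_list_encode: "length xs \<le> list_encode xs"
proof (induction xs)
  case (Cons x xs)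
  then show ?case using le_prod_encode_2[of "list_encode xs" x] by simp
qed simp

lemma computable_on_length:
  assumes "computable_on D e f"
  shows "computable_on D e (\<lambda>z. length (list_decode (f z)))"
proof -
  \<comment> \<open>The length is not known in advance, so the tail is taken \<open>f z\<close>
    times, which suffices because a code is at least as large as the length of its sequence. The
    minimum stops the counter once the sequence is used up.\<close>
  define R where "R = (\<lambda>z i. npair (list_encode (drop i (list_decode (f z)))) (min i (length (list_decode (f z)))))"
  have "computable_on D e (\<lambda>z. R z (f z))"
  proof (rule computable_on_rec[OF assms])
    show "computable_on D e (\<lambda>z. R z 0)"
      unfolding R_def by (simp) (intro computable_on_intros assms)
    let ?D = "{(z, i). z \<in> D \<and> i < f z}" and ?e = "\<lambda>(z, i). npair (e z) (npair i (R z i))"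
    have *: "computable_on ?D ?e (\<lambda>p. psnd (psnd (?e p)))"
      by (intro computable_on_intros computable_on_self)
    have "computable_on ?D ?e (\<lambda>p. npair (tl_code (pfst (psnd (psnd (?e p)))))
        (if pfst (psnd (psnd (?e p))) = 0 then psnd (psnd (psnd (?e p))) else Suc (psnd (psnd (psnd (?e p))))))"
      by (intro computable_on_intros computable_on_tl_code *)
    then show "computable_on ?D ?e (\<lambda>(z, i). R z (Suc i))"
    proof (rule computable_on_cong)
      fix p assume "p \<in> ?D"
      then obtain z i where p: "p = (z, i)" by auto
      have "list_encode (drop i (list_decode (f z))) = 0 \<longleftrightarrow> length (list_decode (f z)) \<le> i"
        by (metis drop_eq_Nil list_encode.simps(1) list_encode_inverse list_decode.simps(1))
      then show "npair (tl_code (pfst (psnd (psnd (?e p)))))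
        (if pfst (psnd (psnd (?e p))) = 0 then psnd (psnd (psnd (?e p)))
         else Suc (psnd (psnd (psnd (?e p))))) = (\<lambda>(z, i). R z (Suc i)) p"
        by (auto simp: p R_def list_encode_drop_Suc)
    qed
  qed
  then have "computable_on D e (\<lambda>z. psnd (R z (f z)))"
    by (rule computable_on_psnd)
  moreover have "psnd (R z (f z)) = length (list_decode (f z))" for z
    using length_le_list_encode[of "list_decode (f z)"] by (simp add: R_def)
  ultimately show ?thesis by simp
qed

text \<open>The step is required to be computable only on accumulators reached after a genuine
  prefix \<open>us\<close>. A fold whose step applies realizers converges because the accumulator
  realizes something about that prefix.\<close>

lemma computable_on_foldl:
  assumes xs: "computable_on D e xs" and a: "computable_on D e a"
    and F: "computable_on
      {(z, y, x). z \<in> D \<and> (\<exists>us vs. list_decode (xs z) = us @ x # vs \<and> y = foldl (F z) (a z) us)}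
      (\<lambda>(z, y, x). npair (e z) (npair y x)) (\<lambda>(z, y, x). F z y x)"
  shows "computable_on D e (\<lambda>z. foldl (F z) (a z) (list_decode (xs z)))"
proof -
  define R where "R = (\<lambda>z i. npair (list_encode (drop i (list_decode (xs z))))
    (foldl (F z) (a z) (take i (list_decode (xs z)))))"
  have "computable_on D e (\<lambda>z. R z (length (list_decode (xs z))))"
  proof (rule computable_on_rec[OF computable_on_length[OF xs]])
    show "computable_on D e (\<lambda>z. R z 0)"
      unfolding R_def by simp (intro computable_on_intros xs a)
    let ?D = "{(z, i). z \<in> D \<and> i < length (list_decode (xs z))}"
      and ?e = "\<lambda>(z, i). npair (e z) (npair i (R z i))"
    let ?p = "\<lambda>p. (fst p, psnd (psnd (psnd (?e p))), hd_code (pfst (psnd (psnd (?e p)))))"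
    have *: "computable_on ?D ?e (\<lambda>p. psnd (psnd (?e p)))" "computable_on ?D ?e (\<lambda>p. pfst (?e p))"
      by (intro computable_on_intros computable_on_self)+
    have **: "computable_on ?D ?e (\<lambda>p. (\<lambda>(z, y, x). F z y x) (?p p))"
    proof (rule computable_on_comp[OF F])
      have "computable_on ?D ?e (\<lambda>p. npair (pfst (?e p)) (npair (psnd (psnd (psnd (?e p)))) (hd_code (pfst (psnd (psnd (?e p)))))))"
        by (intro computable_on_intros computable_on_hd_code *)
      then show "computable_on ?D ?e (\<lambda>p. (\<lambda>(z, y, x). npair (e z) (npair y x)) (?p p))"
        by (rule computable_on_cong) (auto split: prod.splits)
    next
      fix p assume "p \<in> ?D"
      then obtain z i where p: "p = (z, i)" "z \<in> D" "i < length (list_decode (xs z))"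
        by auto
      then show "?p p \<in> {(z, y, x). z \<in> D \<and> (\<exists>us vs. list_decode (xs z) = us @ x # vs \<and> y = foldl (F z) (a z) us)}"
        using id_take_nth_drop[of i "list_decode (xs z)"]
        by (auto simp: R_def hd_code_encode entry_def)
    qed
    have "computable_on ?D ?e (\<lambda>p. npair (tl_code (pfst (psnd (psnd (?e p))))) ((\<lambda>(z, y, x). F z y x) (?p p)))"
      by (intro computable_on_npair computable_on_tl_code computable_on_pfst * **)
    then show "computable_on ?D ?e (\<lambda>(z, i). R z (Suc i))"
    proof (rule computable_on_cong)
      fix p assume "p \<in> ?D"
      then obtain z i where p: "p = (z, i)" "z \<in> D" "i < length (list_decode (xs z))"
        by auto
      then show "npair (tl_code (pfst (psnd (psnd (?e p))))) ((\<lambda>(z, y, x). F z y x) (?p p)) =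
          (\<lambda>(z, i). R z (Suc i)) p"
        by (simp add: R_def list_encode_drop_Suc hd_code_encode entry_def take_Suc_conv_app_nth)
    qed
  qed
  then have "computable_on D e (\<lambda>z. psnd (R z (length (list_decode (xs z)))))"
    by (rule computable_on_psnd)
  then show ?thesis by (simp add: R_def)
qed

definition append_code :: "nat \<Rightarrow> nat \<Rightarrow> nat"
  where "append_code m n = list_encode (list_decode m @ list_decode n)"

lemma list_decode_append_code [simp]:
  "list_decode (append_code m n) = list_decode m @ list_decode n"
  by (simp add: append_code_def)

lemma computable_on_append_code:
  assumes "computable_on D e f" "computable_on D e g"
  shows "computable_on D e (\<lambda>z. append_code (f z) (g z))"
proof -
  \<comment> \<open>Folding with \<open>cons\<close> puts the reversed sequence in front of the
    accumulator. Reversing \<open>f z\<close> onto the empty sequence and the result onto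
    \<open>g z\<close> gives the concatenation.\<close>
  have rev_onto: "computable_on D e (\<lambda>z. foldl (\<lambda>y x. cons x y) (g z) (list_decode (f z)))"
    if "computable_on D e f" "computable_on D e g" for f g
  proof (rule computable_on_foldl[OF that])
    show "computable_on {(z, y, x). z \<in> D \<and> (\<exists>us vs. list_decode (f z) = us @ x # vs \<and>
        y = foldl (\<lambda>y x. cons x y) (g z) us)} (\<lambda>(z, y, x). npair (e z) (npair y x)) (\<lambda>(z, y, x). cons x y)"
      by (rule computable_on_cong[OF computable_on_cons[OF
            computable_on_psnd[OF computable_on_psnd[OF computable_on_self]]
            computable_on_pfst[OF computable_on_psnd[OF computable_on_self]]]]) auto
  qed
  have eq: "foldl (\<lambda>y x. cons x y) n xs = list_encode (rev xs @ list_decode n)" for n xs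
    by (induction xs arbitrary: n) (simp_all add: list_encode_Cons del: list_encode.simps(2))
  have "computable_on D e (\<lambda>z. foldl (\<lambda>y x. cons x y) (g z)
      (list_decode (foldl (\<lambda>y x. cons x y) 0 (list_decode (f z)))))"
    by (intro rev_onto computable_on_const assms)
  then show ?thesis
    by (simp add: eq append_code_def)
qed

text \<open>Only the entries that occur in \<open>xs z\<close> are fed to \<open>F\<close>; this
  admits functions that converge on realizers alone, in particular the application of each entry to
  an argument.\<close>

lemma computable_on_bind_code:
  assumes xs: "computable_on D e xs"
    and F: "computable_on {(z, x). z \<in> D \<and> x \<in> set (list_decode (xs z))} (\<lambda>(z, x). npair (e z) x)
      (\<lambda>p. F (fst p) (snd p))"
  shows "computable_on D e (\<lambda>z. bind_code (F z) (xs z))"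
proof -
  have "computable_on D e (\<lambda>z. foldl (\<lambda>y x. append_code y (F z x)) 0 (list_decode (xs z)))"
  proof (rule computable_on_foldl[OF xs computable_on_const])
    let ?D = "{(z, y, x). z \<in> D \<and> (\<exists>us vs. list_decode (xs z) = us @ x # vs \<and>
        y = foldl (\<lambda>y x. append_code y (F z x)) 0 us)}"
      and ?e = "\<lambda>(z, y, x). npair (e z) (npair y x)"
    have *: "computable_on ?D ?e (\<lambda>p. F (fst p) (snd (snd p)))"
    proof (rule computable_on_comp[OF F, where p="\<lambda>p. (fst p, snd (snd p))", simplified])
      have "computable_on ?D ?e (\<lambda>p. npair (pfst (?e p)) (psnd (psnd (?e p))))"
        by (intro computable_on_intros computable_on_self)
      then show "computable_on ?D ?e (\<lambda>p. npair (e (fst p)) (snd (snd p)))"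
        by (rule computable_on_cong) auto
    qed auto
    have "computable_on ?D ?e (\<lambda>p. append_code (pfst (psnd (?e p))) (F (fst p) (snd (snd p))))"
      by (intro computable_on_append_code computable_on_intros computable_on_self *)
    then show "computable_on ?D ?e (\<lambda>(z, y, x). append_code y (F z x))"
      by (rule computable_on_cong) auto
  qed
  moreover have "foldl (\<lambda>y x. append_code y (F z x)) n xs =
      list_encode (list_decode n @ concat (map (\<lambda>k. list_decode (F z k)) xs))" for z n xs
    by (induction xs arbitrary: n) simp_all
  ultimately show ?thesis
    by (simp add: bind_code_def)
qed

section \<open>Singletons, untagging, pairing and indexing\<close>

abbreviation sing :: "nat \<Rightarrow> nat" where "sing x \<equiv> cons x 0"

lemma list_decode_bind_code [simp]:
  "list_decode (bind_code f n) = concat (map (\<lambda>k. list_decode (f k)) (list_decode n))"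
  by (simp add: bind_code_def)

lemma bind_code_sing [simp]: "bind_code f (sing x) = f x"
  by (simp add: bind_code_def)

lemma list_decode_untag:
  "list_decode (untag t n) =
    map psnd (filter (\<lambda>k. pfst k = t) (list_decode n))"
  by (simp add: untag_def pfst_def psnd_def comp_def)

lemma computable_on_untag:
  assumes "computable_on D e f"
  shows "computable_on D e (\<lambda>z. untag t (f z))"
proof -
  have "computable_on D e (\<lambda>z. bind_code (\<lambda>k. if pfst k = t then sing (psnd k) else 0) (f z))"
    by (intro computable_on_bind_code[OF assms] computable_on_intros computable_on_cons computable_on_context_snd)
  moreover have "bind_code (\<lambda>k. if pfst k = t then sing (psnd k) else 0) n = untag t n" for n
  proof -
    have "concat (map (\<lambda>k. list_decode (if pfst k = t then sing (psnd k) else 0)) xs) =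
      map psnd (filter (\<lambda>k. pfst k = t) xs)" for xs
      by (induction xs) auto
    then have "list_decode (bind_code (\<lambda>k. if pfst k = t then sing (psnd k) else 0) n) = list_decode (untag t n)"
      by (simp add: list_decode_untag)
    then show ?thesis by (metis list_decode_inverse)
  qed
  ultimately show ?thesis by simp
qed

definition pair_code :: "nat \<Rightarrow> nat \<Rightarrow> nat"
  where "pair_code m n = append_code (bind_code (\<lambda>x. sing (npair 0 x)) m) (bind_code (\<lambda>x. sing (npair 1 x)) n)"

lemma computable_on_pair_code:
  assumes "computable_on D e f" "computable_on D e g"
  shows "computable_on D e (\<lambda>z. pair_code (f z) (g z))"
  unfolding pair_code_def
  by (intro computable_on_append_code computable_on_bind_code computable_on_intros
      computable_on_cons computable_on_context_snd assms)

definition upto_code :: "nat \<Rightarrow> nat"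
  where "upto_code n = rec_nat (sing 0) (\<lambda>i y. cons (Suc i) y) n"

lemma set_upto_code [simp]: "set (list_decode (upto_code n)) = {..n}"
  unfolding upto_code_def by (induction n) (auto simp: atMost_Suc)

lemma computable_on_upto_code:
  assumes "computable_on D e f"
  shows "computable_on D e (\<lambda>z. upto_code (f z))"
  unfolding upto_code_def
proof (rule computable_on_rec'[OF assms computable_on_const])
  show "computable_on {(z, i, y). z \<in> D} (\<lambda>(z, i, y). npair (e z) (npair i y)) (\<lambda>(z, i, y). cons (Suc i) y)"
    by (rule computable_on_cong[OF computable_on_cons[OF computable_on_Suc[OF
            computable_on_pfst[OF computable_on_psnd[OF computable_on_self]]]
            computable_on_psnd[OF computable_on_psnd[OF computable_on_self]]]]) auto
qed

definition entry_code :: "nat \<Rightarrow> nat \<Rightarrow> nat"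
  where "entry_code s i = hd_code (rec_nat s (\<lambda>_. tl_code) i)"

lemma entry_code: "entry_code s i = entry (list_decode s) i"
proof -
  have "rec_nat s (\<lambda>_. tl_code) i = list_encode (drop i (list_decode s))"
    by (induction i) (simp_all add: list_encode_drop_Suc)
  then show ?thesis
    by (simp add: entry_code_def hd_code_encode) (simp add: entry_def)
qed

lemma computable_on_entry_code:
  assumes "computable_on D e f" "computable_on D e g"
  shows "computable_on D e (\<lambda>z. entry_code (f z) (g z))"
  unfolding entry_code_def
proof (intro computable_on_hd_code computable_on_rec'[OF assms(2,1)])
  show "computable_on {(z, i, y). z \<in> D} (\<lambda>(z, i, y). npair (e z) (npair i y)) (\<lambda>(z, i, y). tl_code y)"
    by (rule computable_on_cong[OF computable_on_tl_code[OF 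
            computable_on_psnd[OF computable_on_psnd[OF computable_on_self]]]]) auto
qed

definition snoc :: "nat \<Rightarrow> nat \<Rightarrow> nat"
  where "snoc s x = append_code s (sing x)"

lemma list_decode_snoc [simp]: "list_decode (snoc s x) = list_decode s @ [x]"
  by (simp add: snoc_def)

lemma list_encode_snoc: "list_encode (xs @ [x]) = snoc (list_encode xs) x"
  by (metis list_decode_snoc list_decode_inverse list_encode_inverse)

lemma computable_on_snoc:
  "computable_on D e f \<Longrightarrow> computable_on D e g \<Longrightarrow> computable_on D e (\<lambda>z. snoc (f z) (g z))"
  unfolding snoc_def by (intro computable_on_append_code computable_on_cons computable_on_const)


section \<open>A universal function\<close>

text \<open>
  A stack machine that evaluates indices: a state either asks for the value of the function with a
  given index at an argument, or returns a value to a stack of suspended computations.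
\<close>

definition eval_state :: "nat \<Rightarrow> nat \<Rightarrow> nat \<Rightarrow> nat"
  where "eval_state n x K = npair 0 (npair n (npair x K))"

text \<open>The dummy 0 puts the stack in the same place as in \<open>eval_state\<close>, so that
  one projection reads it off either kind of state.\<close>

definition return_state :: "nat \<Rightarrow> nat \<Rightarrow> nat"
  where "return_state v K = npair 1 (npair v (npair 0 K))"

text \<open>The kinds of suspended computation: 0 waits for the first component of a pair, 4 for the
  second, 1 for the inner value of a composition, 2 for the previous value of a recursion, 3 for the
  outcome of a test in a minimization. The other two components hold what is needed to go
  on.\<close>

definition frame :: "nat \<Rightarrow> nat \<Rightarrow> nat \<Rightarrow> nat"
  where "frame k u w = npair k (npair u w)"

definition step_eval :: "nat \<Rightarrow> nat \<Rightarrow> nat \<Rightarrow> nat" where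
  "step_eval n x K =
    (if pfst n = 0 then return_state 0 K
     else if pfst n = 1 then return_state (Suc x) K
     else if pfst n = 2 then return_state (pfst x) K
     else if pfst n = 3 then return_state (psnd x) K
     else if pfst n = 4 then eval_state (pfst (psnd n)) x (cons (frame 0 (psnd (psnd n)) x) K)
     else if pfst n = 5 then eval_state (psnd (psnd n)) x (cons (frame 1 (pfst (psnd n)) 0) K)
     else if pfst n = 6 then
       (if psnd x = 0 then eval_state (pfst (psnd n)) (pfst x) K
        else eval_state n (npair (pfst x) (psnd x - 1))
          (cons (frame 2 (psnd (psnd n)) (npair (pfst x) (psnd x - 1))) K))
     else eval_state (psnd n) (npair x 0) (cons (frame 3 (psnd n) (npair x 0)) K))"

definition step_return :: "nat \<Rightarrow> nat \<Rightarrow> nat \<Rightarrow> nat \<Rightarrow> nat \<Rightarrow> nat" where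
  "step_return v k u w K =
    (if k = 0 then eval_state u w (cons (frame 4 v 0) K)
     else if k = 1 then eval_state u v K
     else if k = 2 then eval_state u (npair (pfst w) (npair (psnd w) v)) K
     else if k = 3 then
       (if v = 0 then return_state (psnd w) K
        else eval_state u (npair (pfst w) (Suc (psnd w)))
          (cons (frame 3 u (npair (pfst w) (Suc (psnd w)))) K))
     else return_state (npair u v) K)"

definition step :: "nat \<Rightarrow> nat" where
  "step s =
    (let a = pfst (psnd s); x = pfst (psnd (psnd s)); K = psnd (psnd (psnd s)) in
     if pfst s = 0 then step_eval a x K
     else if K = 0 then s
     else step_return a (pfst (hd_code K)) (pfst (psnd (hd_code K))) (psnd (psnd (hd_code K))) (tl_code K))"

lemma step_eval_state [simp]: "step (eval_state n x K) = step_eval n x K"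
  by (simp add: step_def eval_state_def)

lemma step_return_state [simp]:
  "step (return_state v (cons (frame k u w) K)) = step_return v k u w K"
  "step (return_state v 0) = return_state v 0"
  by (simp_all add: step_def return_state_def frame_def)

section \<open>Correctness of the machine\<close>

lemma program_unfold:
  "program n =
    (if pfst n = 0 then Zero
     else if pfst n = 1 then Succ
     else if pfst n = 2 then Left
     else if pfst n = 3 then Right
     else if pfst n = 4 then Pair (program (pfst (psnd n))) (program (psnd (psnd n)))
     else if pfst n = 5 then Comp (program (pfst (psnd n))) (program (psnd (psnd n)))
     else if pfst n = 6 then Prec (program (pfst (psnd n))) (program (psnd (psnd n)))
     else Mu (program (psnd n)))"
  using program_npair[of "pfst n" "pfst (psnd n)" "psnd (psnd n)"] by (simp only: npair_collapse)

lemma program_eqD: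
  "program n = Zero \<Longrightarrow> pfst n = 0"
  "program n = Succ \<Longrightarrow> pfst n = 1"
  "program n = Left \<Longrightarrow> pfst n = 2"
  "program n = Right \<Longrightarrow> pfst n = 3"
  "program n = Pair f g \<Longrightarrow>
     pfst n = 4 \<and> program (pfst (psnd n)) = f \<and> program (psnd (psnd n)) = g"
  "program n = Comp f g \<Longrightarrow>
     pfst n = 5 \<and> program (pfst (psnd n)) = f \<and> program (psnd (psnd n)) = g"
  "program n = Prec f g \<Longrightarrow>
     pfst n = 6 \<and> program (pfst (psnd n)) = f \<and> program (psnd (psnd n)) = g"
  "program n = Mu f \<Longrightarrow> 6 < pfst n \<and> program (psnd n) = f"
  using program_unfold[of n] by (auto split: if_splits)

definition reaches :: "nat \<Rightarrow> nat \<Rightarrow> bool"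
  where "reaches s t \<longleftrightarrow> (\<exists>i. (step ^^ i) s = t)"

lemma reaches_refl: "reaches s s"
  unfolding reaches_def by (intro exI[of _ 0]) simp

lemma reaches_step: "reaches (step s) t \<Longrightarrow> reaches s t"
  unfolding reaches_def by (elim exE, rule exI[of _ "Suc _"]) (simp add: funpow_Suc_right del: funpow.simps)

lemma reaches_trans: "reaches s t \<Longrightarrow> reaches t u \<Longrightarrow> reaches s u"
proof -
  assume "reaches s t" "reaches t u"
  then obtain i j where "(step ^^ i) s = t" "(step ^^ j) t = u"
    unfolding reaches_def by blast
  then have "(step ^^ (j + i)) s = u" by (simp add: funpow_add)
  then show ?thesis unfolding reaches_def by blast
qed

text \<open>The stack is arbitrary because a constituent is evaluated on top of the frames of what
  encloses it. The index is arbitrary because a program has many indices.\<close>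

lemma reaches_value:
  "computes c x y \<Longrightarrow> program n = c \<Longrightarrow> reaches (eval_state n x K) (return_state y K)"
proof (induction arbitrary: n K rule: computes.induct)
  case (5 f x a g b)
  note n = program_eqD(5)[OF "5.prems"]
  show ?case
  proof (rule reaches_step)
    have "step (eval_state n x K) =
        eval_state (pfst (psnd n)) x (cons (frame 0 (psnd (psnd n)) x) K)"
      using n by (simp add: step_eval_def)
    moreover have "reaches \<dots> (return_state a (cons (frame 0 (psnd (psnd n)) x) K))"
      using "5.IH"(1) n by blast
    moreover have "reaches \<dots> (eval_state (psnd (psnd n)) x (cons (frame 4 a 0) K))"
      by (rule reaches_step) (simp add: step_return_def reaches_refl)
    moreover have "reaches \<dots> (return_state b (cons (frame 4 a 0) K))"
      using "5.IH"(2) n by blast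
    moreover have "reaches \<dots> (return_state (npair a b) K)"
      by (rule reaches_step) (simp add: step_return_def reaches_refl)
    ultimately show "reaches (step (eval_state n x K)) (return_state (npair a b) K)"
      by (metis reaches_trans)
  qed
next
  case (6 g x y f z)
  note n = program_eqD(6)[OF "6.prems"]
  show ?case
  proof (rule reaches_step)
    have "step (eval_state n x K) =
        eval_state (psnd (psnd n)) x (cons (frame 1 (pfst (psnd n)) 0) K)"
      using n by (simp add: step_eval_def)
    moreover have "reaches \<dots> (return_state y (cons (frame 1 (pfst (psnd n)) 0) K))"
      using "6.IH"(1) n by blast
    moreover have "reaches \<dots> (eval_state (pfst (psnd n)) y K)"
      by (rule reaches_step) (simp add: step_return_def reaches_refl)
    moreover have "reaches \<dots> (return_state z K)"
      using "6.IH"(2) n by blast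
    ultimately show "reaches (step (eval_state n x K)) (return_state z K)"
      by (metis reaches_trans)
  qed
next
  case (7 f a y g)
  note n = program_eqD(7)[OF "7.prems"]
  show ?case
    by (rule reaches_step) (use "7.IH" n in \<open>simp add: step_eval_def\<close>)
next
  case (8 f g a i y z)
  note n = program_eqD(7)[OF "8.prems"]
  show ?case
  proof (rule reaches_step)
    have "step (eval_state n (npair a (Suc i)) K) =
        eval_state n (npair a i) (cons (frame 2 (psnd (psnd n)) (npair a i)) K)"
      using n by (simp add: step_eval_def)
    moreover have "reaches \<dots> (return_state y (cons (frame 2 (psnd (psnd n)) (npair a i)) K))"
      using "8.IH"(1) "8.prems" by blast
    moreover have "reaches \<dots> (eval_state (psnd (psnd n)) (npair a (npair i y)) K)"
      by (rule reaches_step) (simp add: step_return_def reaches_refl)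
    moreover have "reaches \<dots> (return_state z K)"
      using "8.IH"(2) n by blast
    ultimately show "reaches (step (eval_state n (npair a (Suc i)) K)) (return_state z K)"
      by (metis reaches_trans)
  qed
next
  case (9 f a m)
  note n = program_eqD(8)[OF "9.prems"]
  let ?F = "\<lambda>i. cons (frame 3 (psnd n) (npair a i)) K"
  \<comment> \<open>The top frame carries the counter of the minimization; test \<open>i\<close> is
    reached because all the tests before it returned successors.\<close>
  have "reaches (eval_state n a K) (eval_state (psnd n) (npair a i) (?F i))" if "i \<le> m" for i
    using that
  proof (induction i)
    case 0
    show ?case
      by (rule reaches_step) (use n in \<open>simp add: step_eval_def reaches_refl\<close>)
  next
    case (Suc i)
    then have "i < m" by simp
    then obtain v where "reaches (eval_state (psnd n) (npair a i) (?F i)) (return_state (Suc v) (?F i))"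
      using "9.IH"(2)[of i] n by blast
    moreover have "reaches (return_state (Suc v) (?F i)) (eval_state (psnd n) (npair a (Suc i)) (?F (Suc i)))"
      by (rule reaches_step) (simp add: step_return_def reaches_refl)
    ultimately show ?case
      using Suc by (meson Suc_leD reaches_trans)
  qed
  moreover have "reaches (eval_state (psnd n) (npair a m) (?F m)) (return_state 0 (?F m))"
    using "9.IH"(1) n by blast
  moreover have "reaches (return_state 0 (?F m)) (return_state m K)"
    by (rule reaches_step) (simp add: step_return_def reaches_refl)
  ultimately show ?case
    by (meson order_refl reaches_trans)
qed (rule reaches_step, use program_eqD(1-4) in \<open>simp add: step_eval_def reaches_refl\<close>)+

section \<open>Application as a computable operation\<close>

lemma computable_on_step:
  assumes "computable_on D e f"
  shows "computable_on D e (\<lambda>z. step (f z))"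
  unfolding step_def Let_def step_eval_def step_return_def eval_state_def return_state_def frame_def
  by (intro computable_on_if_zero computable_on_if_eq computable_on_intros computable_on_cons
      computable_on_hd_code computable_on_tl_code computable_on_pred assms)

lemma kapp_eq_Some_iff: "n \<bullet> m = Some k \<longleftrightarrow> computes (program n) m k"
proof
  assume "n \<bullet> m = Some k"
  then have "\<exists>k. computes (program n) m k" "k = (THE k. computes (program n) m k)"
    by (auto simp: kapp_def split: if_splits)
  then show "computes (program n) m k"
    by (metis the_equality computes_deterministic)
next
  assume "computes (program n) m k"
  then show "n \<bullet> m = Some k"
    unfolding kapp_def by (metis the_equality computes_deterministic)
qed

lemma universal_computable: "computable_on {(n, m). n \<bullet> m \<noteq> None} (\<lambda>(n, m). npair n m) (\<lambda>(n, m). the (n \<bullet> m))"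
proof -
  let ?D = "{(n, m). n \<bullet> m \<noteq> None}" and ?e = "\<lambda>(n, m). npair n m"
  define run where "run z i = (step ^^ i) (eval_state (fst z) (snd z) 0)" for z :: "nat \<times> nat" and i
  \<comment> \<open>This vanishes exactly on the states that return a value to an empty stack, so
    the least zero along a run is its halting time.\<close>
  define busy where "busy s = (if pfst s = 0 then 1 else psnd (psnd (psnd s)))" for s
  define n where "n z = (LEAST i. busy (run z i) = 0)" for z
  have run: "computable_on D e (\<lambda>z. run (p z) (f z))"
    if "computable_on D e (\<lambda>z. ?e (p z))" "computable_on D e f" for D and e :: "'z \<Rightarrow> nat" and p f
  proof -
    have "computable_on D e (\<lambda>z. npair 0 (npair (pfst (?e (p z))) (npair (psnd (?e (p z))) 0)))"
      by (intro computable_on_intros that)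
    then have 1: "computable_on D e (\<lambda>z. eval_state (fst (p z)) (snd (p z)) 0)"
      by (rule computable_on_cong) (simp add: eval_state_def split: prod.splits)
    have 2: "computable_on {(z, i, y). z \<in> D} (\<lambda>(z, i, y). npair (e z) (npair i y)) (\<lambda>(z, i, y). step y)"
      by (rule computable_on_cong[OF computable_on_step[OF computable_on_psnd[OF
              computable_on_psnd[OF computable_on_self]]]]) auto
    have "rec_nat a (\<lambda>_. step) k = (step ^^ k) a" for a k
      by (induction k) simp_all
    then show ?thesis
      using computable_on_rec'[OF that(2) 1 2] by (simp add: run_def)
  qed
  have halt: "busy (run z (n z)) = 0 \<and> pfst (psnd (run z (n z))) = the (fst z \<bullet> snd z)" if z: "z \<in> ?D" for z
  proof -
    obtain k where k: "fst z \<bullet> snd z = Some k" using z by auto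
    then have "computes (program (fst z)) (snd z) k"
      by (simp add: kapp_eq_Some_iff)
    then obtain i where i: "run z i = return_state k 0"
      using reaches_value[OF _ refl, of "fst z" "snd z" k 0] by (auto simp: reaches_def run_def)
    then have "busy (run z i) = 0"
      by (simp add: busy_def return_state_def)
    then have *: "busy (run z (n z)) = 0" "n z \<le> i"
      unfolding n_def by (rule LeastI, rule Least_le)
    \<comment> \<open>A halted state is a fixed point of \<open>step\<close>. So the state found at
      the least halting time agrees with the state at time \<open>i\<close>, which is known to
      return the right value.\<close>
    have "step (run z (n z)) = run z (n z)"
      using *(1) by (auto simp: step_def busy_def Let_def split: if_splits)
    then have "(step ^^ j) (run z (n z)) = run z (n z)" for j
      by (induction j) auto
    moreover have "run z i = (step ^^ (i - n z)) (run z (n z))"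
      using *(2) by (metis run_def comp_apply funpow_add le_add_diff_inverse2)
    ultimately have "run z (n z) = return_state k 0"
      using i by simp
    then show ?thesis
      using * k by (simp add: return_state_def)
  qed
  have "computable_on ?D ?e n"
  proof (rule computable_on_Least[where F="\<lambda>z i. busy (run z i)"])
    show "busy (run z (n z)) = 0" if "z \<in> ?D" for z
      using halt[OF that] by simp
    show "busy (run z i) \<noteq> 0" if "i < n z" for z i
      using that unfolding n_def by (rule not_less_Least)
    let ?D' = "{(z, i). z \<in> ?D \<and> i \<le> n z}" and ?e' = "\<lambda>(z, i). npair (?e z) i"
    have 1: "computable_on ?D' ?e' (\<lambda>p. ?e (fst p))"
      by (rule computable_on_weaken[OF computable_on_self[of ?D ?e]]) auto
    have "computable_on ?D' ?e' (\<lambda>p. busy (run (fst p) (snd p)))"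
      unfolding busy_def by (intro computable_on_intros run computable_on_context_snd 1)
    then show "computable_on ?D' ?e' (\<lambda>(z, i). busy (run z i))"
      by (rule computable_on_cong) auto
  qed
  then have "computable_on ?D ?e (\<lambda>z. pfst (psnd (run z (n z))))"
    by (intro computable_on_intros run computable_on_self)
  then show ?thesis
    by (rule computable_on_cong) (use halt in force)
qed

lemma computable_on_kapp:
  assumes "computable_on D e f" "computable_on D e g" "\<And>z. z \<in> D \<Longrightarrow> f z \<bullet> g z \<noteq> None"
  shows "computable_on D e (\<lambda>z. the (f z \<bullet> g z))"
  using computable_on_comp[OF universal_computable, of D e "\<lambda>z. (f z, g z)"]
    computable_on_npair[OF assms(1,2)] assms(3) by simp


section \<open>Closures\<close>

text \<open>An index of \<open>Zero\<close> under \<open>x\<close> compositions with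
  \<open>Succ\<close>. Being given by recursion on \<open>x\<close>, the index is itself computable
  from \<open>x\<close>.\<close>

definition const_index :: "nat \<Rightarrow> nat"
  where "const_index x = rec_nat (npair 0 (npair 0 0)) (\<lambda>_ y. npair 5 (npair (npair 1 (npair 0 0)) y)) x"

lemma const_index: "computes (program (const_index x)) y x"
proof (induction x)
  case 0
  have "program (const_index 0) = Zero"
    by (simp add: const_index_def program_npair)
  then show ?case by (simp add: computes.intros(1))
next
  case (Suc x)
  have "program (const_index (Suc x)) = Comp Succ (program (const_index x))"
    by (simp add: const_index_def program_npair)
  with Suc show ?case by (simp add: computes.intros(2,6))
qed

text \<open>The s-m-n function: an index of the map taking \<open>y\<close> to the value of
  \<open>c\<close> at \<open>npair x y\<close>. The final pair of indices, for \<open>Left\<close>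
  and \<open>Right\<close>, stands for the identity, which is not among the basic functions.\<close>

definition closure :: "nat \<Rightarrow> nat \<Rightarrow> nat"
  where "closure c x = npair 5 (npair c (npair 4 (npair (const_index x)
    (npair 4 (npair (npair 2 (npair 0 0)) (npair 3 (npair 0 0)))))))"

lemma closure_kapp: "computes (program c) (npair x y) z \<Longrightarrow> closure c x \<bullet> y = Some z"
proof -
  assume c: "computes (program c) (npair x y) z"
  have "program (closure c x) = Comp (program c) (Pair (program (const_index x)) (Pair Left Right))"
    by (simp add: closure_def program_npair)
  moreover have "computes (Pair Left Right) y y"
    using computes.intros(5)[OF computes.intros(3,4), of "pfst y" "psnd y"] by simp
  then have "computes (Comp (program c) (Pair (program (const_index x)) (Pair Left Right))) y z"
    by (rule computes.intros(6)[OF computes.intros(5)[OF const_index] c])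
  ultimately show ?thesis
    by (simp add: kapp_eq_Some_iff)
qed

lemma computable_on_closure:
  assumes "computable_on D e f"
  shows "computable_on D e (\<lambda>z. closure c (f z))"
proof -
  have "computable_on {(z, i, y). z \<in> D} (\<lambda>(z, i, y). npair (e z) (npair i y))
      (\<lambda>(z, i, y). npair 5 (npair (npair 1 (npair 0 0)) y))"
    by (rule computable_on_cong[OF computable_on_npair[OF computable_on_const
        computable_on_npair[OF computable_on_const computable_on_psnd[OF computable_on_psnd[OF computable_on_self]]]]])
      auto
  from computable_on_rec'[OF assms computable_on_const this]
  have "computable_on D e (\<lambda>z. const_index (f z))"
    unfolding const_index_def .
  then show ?thesis
    unfolding closure_def by (intro computable_on_intros)
qed

text \<open>One index \<open>c\<close> serves for all \<open>z\<close>, since \<open>z\<close>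
  enters through \<open>e z\<close> only. Restricting the argument to \<open>Y z\<close> leaves room
  for functions that converge merely on potential realizers.\<close>

lemma closure_exists:
  assumes "computable_on {(z, y). z \<in> D \<and> y \<in> Y z} (\<lambda>(z, y). npair (e z) y) (\<lambda>p. H (fst p) (snd p))"
  shows "\<exists>c. \<forall>z\<in>D. \<forall>y\<in>Y z. closure c (e z) \<bullet> y = Some (H z y)"
proof -
  obtain d where d: "\<And>z y. z \<in> D \<Longrightarrow> y \<in> Y z \<Longrightarrow> computes d (npair (e z) y) (H z y)"
    using assms unfolding computable_on_def by fastforce
  obtain c where "program c = d"
    using surj_program by (metis surjD)
  then show ?thesis
    using d closure_kapp by metis
qed

lemma total_index_exists:
  assumes "computable_on UNIV (\<lambda>x. x) H"
  shows "\<exists>r. \<forall>m. r \<bullet> m = Some (H m)"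
proof -
  obtain c where "\<And>m. computes c m (H m)"
    using assms unfolding computable_on_def by blast
  moreover obtain r where "program r = c"
    using surj_program by (metis surjD)
  ultimately show ?thesis
    by (intro exI[of _ r]) (simp add: kapp_eq_Some_iff)
qed

lemma total_closure_exists:
  assumes "computable_on UNIV (\<lambda>(x, y). npair x y) (\<lambda>p. H (fst p) (snd p))"
  shows "\<exists>c. \<forall>x y. closure c x \<bullet> y = Some (H x y)"
  using closure_exists[where D=UNIV and Y="\<lambda>_. UNIV" and e="\<lambda>x. x" and H=H] assms by simp

lemmas computable_on_code_intros =
  computable_on_intros computable_on_cons computable_on_length computable_on_append_code
  computable_on_bind_code computable_on_untag computable_on_pair_code computable_on_upto_code
  computable_on_entry_code computable_on_snoc computable_on_closure


section \<open>Realizers of compound formulas\<close>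

lemma pot_conj: "pot (p \<^bold>\<and> q) = tagged_sum (pot p) (pot q)"
  by transfer auto

lemma act_conj:
  "act (p \<^bold>\<and> q) = {n \<in> bang (tagged_sum (pot p) (pot q)). untag 0 n \<in> act p \<and> untag 1 n \<in> act q}"
  by transfer auto

lemma pot_disj: "pot (p \<^bold>\<or> q) = tagged_sum (pot p) (pot q)"
  by transfer auto

lemma act_disj:
  "act (p \<^bold>\<or> q) = {n \<in> bang (tagged_sum (pot p) (pot q)). untag 0 n \<in> act p \<or> untag 1 n \<in> act q}"
  by transfer auto

lemma pot_imp: "pot (p \<^bold>\<longrightarrow> q) = imp_pot (pot p) (pot q)"
  by transfer auto

definition ap :: "nat \<Rightarrow> nat \<Rightarrow> nat"
  where "ap n m = bind_code (\<lambda>r. the (r \<bullet> m)) n"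

lemma act_imp:
  "act (p \<^bold>\<longrightarrow> q) = {n \<in> bang (imp_pot (pot p) (pot q)). \<forall>m\<in>act p. ap n m \<in> act q}"
  unfolding ap_def by transfer auto

lemma pot_all: "pot (hall \<phi>) = (\<Inter>x. pot (\<phi> x))"
  by transfer auto

lemma act_all: "act (hall \<phi>) = (\<Inter>x. act (\<phi> x))"
  by transfer auto

lemma pot_ex: "pot (hex \<phi>) = (\<Union>x. bang (pot (\<phi> x)))"
  by transfer auto

lemma act_ex:
  "act (hex \<phi>) = {n \<in> bang (\<Union>x. bang (pot (\<phi> x))). \<exists>x. \<exists>m\<in>set (list_decode n). m \<in> act (\<phi> x)}"
  by transfer auto

lemma pot_bot: "pot \<^bold>\<bottom> = {}" and act_bot: "act \<^bold>\<bottom> = {}"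
  by (transfer, auto)+

lemma pot_is_code: "pot (is_code k) = {k}"
  and act_is_code: "act (is_code k) = {n \<in> bang {k}. list_decode n \<noteq> []}"
  by (transfer, auto)+

text \<open>
  With \<open>G\<close> false only potential realizability is claimed. Treating both cases at once means that
  each realizer has to be verified only once.
\<close>

definition realizes :: "bool \<Rightarrow> nat \<Rightarrow> hprop \<Rightarrow> bool"
  where "realizes G n p \<longleftrightarrow> n \<in> bang (pot p) \<and> (G \<longrightarrow> n \<in> act p)"

lemma realizes_weaken: "realizes G n p \<Longrightarrow> (H \<Longrightarrow> G) \<Longrightarrow> realizes H n p"
  by (auto simp: realizes_def)

lemma realizes_False: "realizes G n p \<Longrightarrow> realizes False n p"
  by (auto simp: realizes_def)

lemma realizes_True_iff: "realizes True n p \<longleftrightarrow> n \<in> act p"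
  using act_subset by (auto simp: realizes_def)

text \<open>The basic Herbrand rule: concatenating candidates is harmless as long as each is a
  potential realizer, and by upward closure one actual realizer among them makes the whole
  actual.\<close>

lemma realizes_bind_code:
  assumes "\<And>k. k \<in> set (list_decode n) \<Longrightarrow> realizes False (F k) p"
    and "G \<Longrightarrow> \<exists>k\<in>set (list_decode n). realizes True (F k) p"
  shows "realizes G (bind_code F n) p"
proof -
  have "bind_code F n \<in> bang (pot p)"
    using assms(1) by (fastforce simp: realizes_def bang_def)
  moreover have "bind_code F n \<in> act p" if G
  proof -
    obtain k where "k \<in> set (list_decode n)" "F k \<in> act p"
      using assms(2)[OF \<open>G\<close>] by (auto simp: realizes_True_iff)
    moreover have "F k \<preceq> bind_code F n"
      using \<open>k \<in> set (list_decode n)\<close> by (auto simp: below_def)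
    ultimately show ?thesis
      using \<open>bind_code F n \<in> bang (pot p)\<close> act_up by blast
  qed
  ultimately show ?thesis by (simp add: realizes_def)
qed

lemma realizes_append_code:
  assumes "realizes G m p" "realizes H n p"
  shows "realizes (G \<or> H) (append_code m n) p"
proof -
  have pot: "append_code m n \<in> bang (pot p)"
    using assms by (auto simp: realizes_def bang_def)
  moreover have "m \<preceq> append_code m n" "n \<preceq> append_code m n"
    by (auto simp: below_def)
  ultimately show ?thesis
    using assms act_up[OF _ pot] by (auto simp: realizes_def)
qed

lemma realizes_empty: "realizes False 0 p"
  by (simp add: realizes_def bang_def)

section \<open>Rules for the connectives and quantifiers\<close>

lemma realizes_conj_iff:
  "realizes G n (p \<^bold>\<and> q) \<longleftrightarrow> n \<in> bang (tagged_sum (pot p) (pot q)) \<and>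
    realizes G (untag 0 n) p \<and> realizes G (untag 1 n) q"
  using untag_bang[of n "pot p" "pot q"] by (auto simp: realizes_def pot_conj act_conj)

lemma realizes_conjD:
  assumes "realizes G n (p \<^bold>\<and> q)"
  shows "realizes G (untag 0 n) p" "realizes G (untag 1 n) q"
  using assms by (simp_all add: realizes_conj_iff)

lemma list_decode_pair_code:
  "list_decode (pair_code m n) = map (npair 0) (list_decode m) @ map (npair 1) (list_decode n)"
proof -
  have "concat (map (\<lambda>x. list_decode (sing (npair t x))) xs) = map (npair t) xs" for t xs
    by (induction xs) auto
  then show ?thesis
    by (simp add: pair_code_def)
qed

lemma untag_pair_code [simp]: "untag 0 (pair_code m n) = m" "untag 1 (pair_code m n) = n"
proof -
  have "list_decode (untag 0 (pair_code m n)) = list_decode m"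
    "list_decode (untag 1 (pair_code m n)) = list_decode n"
    by (simp_all add: list_decode_untag list_decode_pair_code filter_map comp_def)
  then show "untag 0 (pair_code m n) = m" "untag 1 (pair_code m n) = n"
    by (metis list_decode_inverse)+
qed

lemma realizes_pair_code:
  assumes "realizes G m p" "realizes G n q"
  shows "realizes G (pair_code m n) (p \<^bold>\<and> q)"
proof -
  have "pair_code m n \<in> bang (tagged_sum (pot p) (pot q))"
    using assms by (auto simp: realizes_def bang_def list_decode_pair_code tagged_sum_def)
  then show ?thesis
    using assms by (simp only: realizes_conj_iff untag_pair_code)
qed

lemma realizes_ap:
  assumes "realizes G n (p \<^bold>\<longrightarrow> q)" "realizes G m p"
  shows "realizes G (ap n m) q"
  using assms bind_imp_bang[of n "pot p" "pot q" m]
  by (auto simp: realizes_def pot_imp act_imp ap_def)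

text \<open>The guard \<open>H\<close> of the argument passes to the value. \<open>H\<close> false
  gives convergence and potential realizability, \<open>H\<close> true the actual case, which arises
  only if \<open>G\<close> is true; both come from a single verification.\<close>

lemma realizes_impI:
  assumes "\<And>H m. (H \<Longrightarrow> G) \<Longrightarrow> realizes H m p \<Longrightarrow> r \<bullet> m = Some (F m)"
    and "\<And>H m. (H \<Longrightarrow> G) \<Longrightarrow> realizes H m p \<Longrightarrow> realizes H (F m) q"
  shows "realizes G (sing r) (p \<^bold>\<longrightarrow> q)"
proof -
  have F: "r \<bullet> m = Some (F m)" "F m \<in> bang (pot q)" if "m \<in> bang (pot p)" for m
    using assms[of False m] that by (auto simp: realizes_def)
  then have "sing r \<in> bang (imp_pot (pot p) (pot q))"
    by (auto simp: bang_def imp_pot_def)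
  moreover have "ap (sing r) m \<in> act q" if G "m \<in> act p" for m
    using assms[of True m] that by (simp add: realizes_True_iff ap_def)
  ultimately show ?thesis
    by (simp add: realizes_def pot_imp act_imp)
qed

lemma bang_Inter: "bang (\<Inter>x. A x) = (\<Inter>x. bang (A x))"
  by (auto simp: bang_def)

lemma realizes_all_iff: "realizes G n (hall \<phi>) \<longleftrightarrow> (\<forall>x. realizes G n (\<phi> x))"
  by (auto simp: realizes_def pot_all act_all bang_Inter)

lemma realizes_All_in_iff:
  "realizes G n (All_in X \<phi>) \<longleftrightarrow> (\<forall>x. realizes G n (exists_in X x \<^bold>\<longrightarrow> \<phi> x))"
  by (simp add: All_in_def realizes_all_iff)

lemma realizes_exI:
  assumes "\<And>k. k \<in> set (list_decode n) \<Longrightarrow> \<exists>x. realizes False k (\<phi> x)"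
    and "G \<Longrightarrow> \<exists>k\<in>set (list_decode n). \<exists>x. realizes True k (\<phi> x)"
  shows "realizes G n (hex \<phi>)"
  using assms unfolding realizes_True_iff by (force simp: realizes_def pot_ex act_ex bang_def)

lemma realizes_ex_sing: "realizes G k (\<phi> x) \<Longrightarrow> realizes G (sing k) (hex \<phi>)"
  by (rule realizes_exI) (auto simp: realizes_def)

lemma realizes_exD:
  assumes "realizes G n (hex \<phi>)"
  shows "k \<in> set (list_decode n) \<Longrightarrow> \<exists>x. realizes False k (\<phi> x)"
    and "G \<Longrightarrow> \<exists>k\<in>set (list_decode n). \<exists>x. realizes True k (\<phi> x)"
  using assms unfolding realizes_True_iff by (force simp: realizes_def pot_ex act_ex bang_def)+

lemma realizes_bot_iff: "realizes G n \<^bold>\<bottom> \<longleftrightarrow> n = 0 \<and> \<not> G"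
proof -
  have "list_decode n = [] \<longleftrightarrow> n = 0"
    by (metis list_decode_inverse list_encode.simps(1) list_decode.simps(1))
  then show ?thesis by (auto simp: realizes_def pot_bot act_bot bang_def)
qed

section \<open>Realizers for numbers and coded sequences\<close>

lemma realizes_code_iff:
  "realizes G n (is_code k) \<longleftrightarrow> set (list_decode n) \<subseteq> {k} \<and> (G \<longrightarrow> list_decode n \<noteq> [])"
  by (auto simp: realizes_def pot_is_code act_is_code bang_def)

lemma realizes_coded_iff:
  "realizes G n (coded_obj c x y) \<longleftrightarrow>
    (\<forall>k\<in>set (list_decode n). x = y \<and> k = c x) \<and> (G \<longrightarrow> x = y \<and> list_decode n \<noteq> [])"
proof -
  have "list_decode n = [] \<longleftrightarrow> n = 0"
    by (metis list_decode_inverse list_encode.simps(1) list_decode.simps(1))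
  then show ?thesis
    by (auto simp: coded_obj_def realizes_code_iff realizes_bot_iff)
qed

lemma realizes_nat_iff:
  "realizes G n (\<^bold>N x y) \<longleftrightarrow>
    (\<forall>k\<in>set (list_decode n). x = y \<and> k = x) \<and> (G \<longrightarrow> x = y \<and> list_decode n \<noteq> [])"
  by (simp add: nat_obj_def realizes_coded_iff)

lemma realizes_seq_iff:
  "realizes G n (\<^bold>S s t) \<longleftrightarrow>
    (\<forall>k\<in>set (list_decode n). s = t \<and> k = list_encode s) \<and> (G \<longrightarrow> s = t \<and> list_decode n \<noteq> [])"
  by (simp add: seq_obj_def realizes_coded_iff)

lemma realizes_sing_nat: "realizes G (sing n) (\<^bold>N n n)"
  by (simp add: realizes_nat_iff)

lemma realizes_sing_seq: "realizes G (sing s) (\<^bold>S (list_decode s) (list_decode s))"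
  by (simp add: realizes_seq_iff)

section \<open>Truth as existence of an actual realizer\<close>

lemma holds_iff: "holds p \<longleftrightarrow> (\<exists>n. realizes True n p)"
proof
  assume "holds p"
  then obtain r where "\<forall>n\<in>act \<^bold>\<top>. \<exists>k. r \<bullet> n = Some k \<and> k \<in> act p"
    by (auto simp: holds_def entails_def)
  moreover have "0 \<in> act \<^bold>\<top>"
    by transfer simp
  ultimately show "\<exists>n. realizes True n p"
    by (auto simp: realizes_True_iff)
next
  assume "\<exists>n. realizes True n p"
  then obtain n where "n \<in> act p" by (auto simp: realizes_True_iff)
  moreover obtain r where "\<And>m. r \<bullet> m = Some n"
    using total_index_exists[OF computable_on_const] by blast
  ultimately show "holds p"
    using act_subset unfolding holds_def entails_def by (intro exI[of _ r]) auto
qed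

lemma holds_if_realizes: "realizes G n p \<Longrightarrow> G \<Longrightarrow> holds p"
  by (auto simp: holds_iff)

lemma holds_conjD: "holds (p \<^bold>\<and> q) \<Longrightarrow> holds p \<and> holds q"
  using realizes_conjD unfolding holds_iff by blast

lemma holds_impD: "holds (p \<^bold>\<longrightarrow> q) \<Longrightarrow> holds p \<Longrightarrow> holds q"
  using realizes_ap unfolding holds_iff by blast

lemma holds_allD: "holds (hall \<phi>) \<Longrightarrow> holds (\<phi> x)"
  by (auto simp: holds_iff realizes_all_iff)

lemma holds_conjI: "holds p \<Longrightarrow> holds q \<Longrightarrow> holds (p \<^bold>\<and> q)"
  using realizes_pair_code unfolding holds_iff by blast

lemma holds_exI: "holds (\<phi> x) \<Longrightarrow> holds (hex \<phi>)"
  using realizes_ex_sing[where \<phi>=\<phi> and x=x] unfolding holds_iff by blast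

lemma holds_exD: "holds (hex \<phi>) \<Longrightarrow> \<exists>x. holds (\<phi> x)"
  using realizes_exD(2)[where \<phi>=\<phi> and G=True] unfolding holds_iff by blast

lemma holds_coded_iff: "holds (coded_obj c x y) \<longleftrightarrow> x = y"
proof
  assume "x = y"
  then have "realizes True (sing (c x)) (coded_obj c x y)"
    by (simp add: realizes_coded_iff)
  then show "holds (coded_obj c x y)" by (auto simp: holds_iff)
qed (auto simp: holds_iff realizes_coded_iff)

lemma holds_nat_iff: "holds (\<^bold>N x y) \<longleftrightarrow> x = y"
  by (simp add: nat_obj_def holds_coded_iff)

lemma holds_All_in_natD: "holds (All_in \<^bold>N \<phi>) \<Longrightarrow> holds (\<phi> n)"
  unfolding All_in_def using holds_allD[of "\<lambda>x. exists_in \<^bold>N x \<^bold>\<longrightarrow> \<phi> x"] holds_impD holds_nat_iff by blast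

lemma holds_le_nat_iff: "holds (le_nat m n) \<longleftrightarrow> m \<le> n"
proof
  assume "holds (le_nat m n)"
  then obtain k where "holds (exists_in \<^bold>N k \<^bold>\<and> \<^bold>N (m + k) n)"
    unfolding le_nat_def Ex_in_def by (auto dest: holds_exD)
  then show "m \<le> n"
    by (auto dest!: holds_conjD simp: holds_nat_iff)
next
  assume "m \<le> n"
  then have "holds (exists_in \<^bold>N (n - m) \<^bold>\<and> \<^bold>N (m + (n - m)) n)"
    by (intro holds_conjI) (simp_all add: holds_nat_iff)
  then show "holds (le_nat m n)"
    unfolding le_nat_def Ex_in_def by (rule holds_exI)
qed

text \<open>If \<open>p\<close> holds, nothing actually realizes its negation, since falsity has no
  actual realizer; an actual realizer of the disjunction must then be right in its first half. So a
  candidate realizer of \<open>p\<close> is obtained without deciding \<open>p\<close>.\<close>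

lemma realizes_decidable:
  assumes "realizes G n (p \<^bold>\<or> \<^bold>\<not> p)"
  shows "realizes (G \<and> holds p) (untag 0 n) p"
proof -
  have n: "n \<in> bang (tagged_sum (pot p) (pot (\<^bold>\<not> p)))"
    using assms by (simp add: realizes_def pot_disj)
  moreover have "untag 0 n \<in> act p" if G "holds p"
  proof -
    have "untag 0 n \<in> act p \<or> untag 1 n \<in> act (\<^bold>\<not> p)"
      using assms \<open>G\<close> by (simp add: realizes_def act_disj)
    moreover have "untag 1 n \<notin> act (\<^bold>\<not> p)"
      using \<open>holds p\<close> by (auto simp: act_imp act_bot holds_iff realizes_True_iff)
    ultimately show ?thesis by blast
  qed
  ultimately show ?thesis
    using untag_bang[OF n] by (simp add: realizes_def)
qed

text \<open>Potential realizability suffices for convergence, because \<open>imp_pot\<close> demands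
  a value at every potential realizer. The formulas may vary with \<open>z\<close>; the program does
  not see them.\<close>

lemma computable_on_ap:
  assumes "computable_on D e f" "computable_on D e g"
    and "\<And>z. z \<in> D \<Longrightarrow> \<exists>p q. realizes False (f z) (p \<^bold>\<longrightarrow> q) \<and> realizes False (g z) p"
  shows "computable_on D e (\<lambda>z. ap (f z) (g z))"
  unfolding ap_def
proof (rule computable_on_bind_code[OF assms(1)])
  show "computable_on {(z, x). z \<in> D \<and> x \<in> set (list_decode (f z))} (\<lambda>(z, x). npair (e z) x)
     (\<lambda>p. the (snd p \<bullet> g (fst p)))"
  proof (rule computable_on_kapp[OF computable_on_context_snd computable_on_weaken[OF assms(2)]])
    fix p assume "p \<in> {(z, x). z \<in> D \<and> x \<in> set (list_decode (f z))}"
    then obtain z r where p: "p = (z, r)" "z \<in> D" "r \<in> set (list_decode (f z))" by auto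
    then show "snd p \<bullet> g (fst p) \<noteq> None"
      using assms(3)[OF p(2)] by (fastforce simp: realizes_def pot_imp bang_def imp_pot_def)
  qed auto
qed


section \<open>Bounding a finitely branching tree\<close>

abbreviation fan :: "(nat list \<Rightarrow> hprop) \<Rightarrow> hprop"
  where "fan T \<equiv> tree T \<^bold>\<and> finitely_branching T"

text \<open>A candidate realizer of membership of \<open>s\<close> in the tree. The three outer
  selections lead from \<open>fan T\<close> to the decidability clause, and the last takes the
  positive half of the disjunction.\<close>

definition node :: "nat \<Rightarrow> nat \<Rightarrow> nat"
  where "node tf s = untag 0 (ap (untag 0 (untag 1 (untag 0 tf))) (sing s))"

lemma realizes_fanD:
  assumes "realizes G tf (fan T)"
  shows "realizes G (untag 0 (untag 1 (untag 0 tf))) (\<^bold>S t t \<^bold>\<longrightarrow> T t \<^bold>\<or> \<^bold>\<not> T t)"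
    and "realizes G (untag 1 tf)
      (\<^bold>S t t \<^bold>\<longrightarrow> T t \<^bold>\<longrightarrow> (\<^bold>\<exists>z\<^bold>\<in>\<^bold>N. \<^bold>\<forall>x\<^bold>\<in>\<^bold>N. T (t @ [x]) \<^bold>\<longrightarrow> le_nat x z))"
  using realizes_conjD(1)[OF realizes_conjD(2)[OF realizes_conjD(1)[OF assms, unfolded tree_def]]]
    realizes_conjD(2)[OF assms]
  by (simp_all only: finitely_branching_def realizes_All_in_iff)

lemma realizes_node:
  assumes "realizes G tf (fan T)"
  shows "realizes (G \<and> holds (T (list_decode s))) (node tf s) (T (list_decode s))"
  unfolding node_def
  by (rule realizes_decidable[OF realizes_ap[OF realizes_fanD(1)[OF assms] realizes_sing_seq]])

lemma computable_on_node:
  assumes "computable_on D e f" "computable_on D e g" "\<And>z. z \<in> D \<Longrightarrow> \<exists>T. realizes False (f z) (fan T)"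
  shows "computable_on D e (\<lambda>z. node (f z) (g z))"
  unfolding node_def
proof (intro computable_on_untag computable_on_ap computable_on_cons computable_on_const assms(1,2))
  fix z assume "z \<in> D"
  then obtain T where "realizes False (f z) (fan T)" using assms(3) by blast
  then show "\<exists>p q. realizes False (untag 0 (untag 1 (untag 0 (f z)))) (p \<^bold>\<longrightarrow> q) \<and> realizes False (sing (g z)) p"
    using realizes_fanD(1) realizes_sing_seq by blast
qed

text \<open>
  The code of a sequence is at least as large as its entries, so that the code of a realizer of an
  existential statement about numbers bounds all the witnesses which it proposes.
\<close>

definition branching_bound :: "nat \<Rightarrow> nat \<Rightarrow> nat"
  where "branching_bound tf s = ap (ap (untag 1 tf) (sing s)) (node tf s)"

lemma entry_le_code: "x \<in> set (list_decode n) \<Longrightarrow> x \<le> n"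
proof (induction n rule: list_decode.induct)
  case (2 n)
  then show ?case
    by (auto simp: le_Suc_eq split: prod.splits)
      (metis le_SucI le_prod_encode_1 le_prod_encode_2 order_trans prod_decode_inverse)+
qed simp

lemma tagged_le_code:
  assumes "x \<in> set (list_decode (untag t n))"
  shows "x \<le> n"
proof -
  have "npair t x \<in> set (list_decode n)"
    using assms by (auto simp: list_decode_untag)
  then show ?thesis
    using entry_le_code le_prod_encode_2[of x t] by (meson order_trans)
qed

lemma realizes_branching_bound:
  assumes "realizes G tf (fan T)"
  shows "realizes (G \<and> holds (T (list_decode s))) (branching_bound tf s)
    (\<^bold>\<exists>z\<^bold>\<in>\<^bold>N. \<^bold>\<forall>x\<^bold>\<in>\<^bold>N. T (list_decode s @ [x]) \<^bold>\<longrightarrow> le_nat x z)"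
  unfolding branching_bound_def
  by (rule realizes_ap[OF realizes_ap[OF realizes_weaken[OF realizes_fanD(2)[OF assms]] realizes_sing_seq]
        realizes_node[OF assms]]) simp

lemma branching_bound:
  assumes "realizes True tf (fan T)" "holds (T (list_decode s))" "holds (T (list_decode s @ [x]))"
  shows "x \<le> branching_bound tf s"
proof -
  have "realizes True (branching_bound tf s)
      (\<^bold>\<exists>z\<^bold>\<in>\<^bold>N. \<^bold>\<forall>x\<^bold>\<in>\<^bold>N. T (list_decode s @ [x]) \<^bold>\<longrightarrow> le_nat x z)"
    using realizes_branching_bound[OF assms(1), of s] assms(2) by simp
  from realizes_exD(2)[OF this[unfolded Ex_in_def]] obtain k z
    where k: "k \<in> set (list_decode (branching_bound tf s))"
      "realizes True k (exists_in \<^bold>N z \<^bold>\<and> (\<^bold>\<forall>x\<^bold>\<in>\<^bold>N. T (list_decode s @ [x]) \<^bold>\<longrightarrow> le_nat x z))"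
    by blast
  have "realizes True (untag 0 k) (\<^bold>N z z)"
    using realizes_conjD(1)[OF k(2)] .
  then have "z \<in> set (list_decode (untag 0 k))"
    by (cases "list_decode (untag 0 k)") (auto simp: realizes_nat_iff)
  then have "z \<le> branching_bound tf s"
    using tagged_le_code entry_le_code[OF k(1)] by (meson order_trans)
  moreover have "holds (le_nat x z)"
    using holds_if_realizes[OF realizes_conjD(2)[OF k(2)]] assms(3) holds_All_in_natD holds_impD
    by blast
  ultimately show ?thesis
    by (simp add: holds_le_nat_iff)
qed

lemma computable_on_branching_bound:
  assumes "computable_on D e f" "computable_on D e g" "\<And>z. z \<in> D \<Longrightarrow> \<exists>T. realizes False (f z) (fan T)"
  shows "computable_on D e (\<lambda>z. branching_bound (f z) (g z))"
  unfolding branching_bound_def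
proof (intro computable_on_untag computable_on_ap computable_on_cons computable_on_const
    computable_on_node assms)
  fix z assume "z \<in> D"
  then obtain T where T: "realizes False (f z) (fan T)" using assms(3) by blast
  note * = realizes_fanD(2)[OF T] realizes_sing_seq
  show "\<exists>p q. realizes False (untag 1 (f z)) (p \<^bold>\<longrightarrow> q) \<and> realizes False (sing (g z)) p"
    using * by blast
  show "\<exists>p q. realizes False (ap (untag 1 (f z)) (sing (g z))) (p \<^bold>\<longrightarrow> q) \<and> realizes False (node (f z) (g z)) p"
    using realizes_ap[OF *] realizes_False[OF realizes_node[OF T]] by blast
qed

text \<open>
  Which sequences belong to the tree cannot be decided, so these are only candidates for the nodes
  of a given length.
\<close>

definition level :: "nat \<Rightarrow> nat \<Rightarrow> nat"
  where "level tf n = rec_nat (sing 0)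
    (\<lambda>_. bind_code (\<lambda>s. bind_code (\<lambda>x. sing (snoc s x)) (upto_code (branching_bound tf s)))) n"

lemma computable_on_level:
  assumes "computable_on D e f" "computable_on D e g" "\<And>z. z \<in> D \<Longrightarrow> \<exists>T. realizes False (f z) (fan T)"
  shows "computable_on D e (\<lambda>z. level (f z) (g z))"
  unfolding level_def
proof (rule computable_on_rec'[OF assms(2) computable_on_const])
  note f = computable_on_weaken2[OF assms(1), where D'="{(z, i, y). z \<in> D}"]
  have "computable_on {(z, i, y). z \<in> D} (\<lambda>(z, i, y). npair (e z) (npair i y))
     (\<lambda>p. bind_code (\<lambda>s. bind_code (\<lambda>x. sing (snoc s x)) (upto_code (branching_bound (f (fst p)) s))) (snd (snd p)))"
    by (intro computable_on_code_intros computable_on_branching_bound computable_on_context_snd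
        computable_on_context_snd' computable_on_context_last computable_on_weaken[OF f])
      (use assms(3) in auto)
  then show "computable_on {(z, i, y). z \<in> D} (\<lambda>(z, i, y). npair (e z) (npair i y))
     (\<lambda>(z, i, y). bind_code (\<lambda>s. bind_code (\<lambda>x. sing (snoc s x)) (upto_code (branching_bound (f z) s))) y)"
    by (rule computable_on_cong) auto
qed

lemma length_level: "s \<in> set (list_decode (level tf n)) \<Longrightarrow> length (list_decode s) = n"
  by (induction n arbitrary: s) (auto simp: level_def)

section \<open>Paths as functions and bounds for their values\<close>

definition segment :: "(nat \<Rightarrow> nat) \<Rightarrow> nat \<Rightarrow> nat list"
  where "segment f n = map f [0..<n]"

lemma segment_simps [simp]: "segment f 0 = []" "segment f (Suc n) = segment f n @ [f n]"
  by (simp_all add: segment_def)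

lemma length_segment [simp]: "length (segment f n) = n"
  by (simp add: segment_def)

text \<open>The induction uses the branching bounds only at nodes of the path, where they are valid.
  Meaningless bounds at candidates off the tree can only add further candidates.\<close>

lemma segment_in_level:
  assumes "realizes True tf (fan T)" "\<And>n. holds (T (segment f n))"
  shows "list_encode (segment f n) \<in> set (list_decode (level tf n))"
proof (induction n)
  case (Suc n)
  have "f n \<le> branching_bound tf (list_encode (segment f n))"
    using branching_bound[OF assms(1), of "list_encode (segment f n)" "f n"]
      assms(2)[of n] assms(2)[of "Suc n"] by simp
  then show ?case
    using Suc by (auto simp: level_def list_encode_snoc)
qed (simp add: level_def)

text \<open>The value at \<open>n\<close> is the last entry of the segment of length
  \<open>Suc n\<close>, whose code is an entry of that level; a code dominates its entries, and this
  is used twice. The resulting bound is computed from \<open>tf\<close> without knowledge of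
  \<open>f\<close>.\<close>

lemma value_le_level:
  assumes "realizes True tf (fan T)" "\<And>n. holds (T (segment f n))"
  shows "f n \<le> level tf (Suc n)"
proof -
  have "f n \<le> list_encode (segment f (Suc n))"
    by (rule entry_le_code) simp
  also have "\<dots> \<le> level tf (Suc n)"
    by (rule entry_le_code[OF segment_in_level[OF assms]])
  finally show ?thesis .
qed


section \<open>All classical paths are internal paths\<close>

text \<open>
  The potential realizers of the graph of a function do not depend on the function, so that the
  graphs of all the classical paths share their realizers.
\<close>

lift_definition guarded_code :: "bool \<Rightarrow> nat \<Rightarrow> hprop"
  is "\<lambda>P k. ({n \<in> bang {k}. P \<and> list_decode n \<noteq> []}, {k})"
  by (auto simp: upclosed_in_def below_def)

definition graph :: "(nat \<Rightarrow> nat) \<Rightarrow> nat \<Rightarrow> nat \<Rightarrow> hprop"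
  where "graph f x y = guarded_code (f x = y) (npair x y)"

lemma realizes_graph_iff:
  "realizes G n (graph f x y) \<longleftrightarrow>
    set (list_decode n) \<subseteq> {npair x y} \<and> (G \<longrightarrow> f x = y \<and> list_decode n \<noteq> [])"
proof -
  have "pot (guarded_code P k) = {k}"
    "act (guarded_code P k) = {n \<in> bang {k}. P \<and> list_decode n \<noteq> []}" for P k
    by (transfer, simp)+
  then show ?thesis
    by (auto simp: realizes_def graph_def bang_def)
qed

lemma holds_graphD: "holds (graph f x y) \<Longrightarrow> f x = y"
  by (auto simp: holds_iff realizes_graph_iff)

text \<open>\<open>F\<close> receives \<open>tf\<close> only, so one number realizes the
  functionality of every classical path at once. For \<open>G\<close> false, \<open>f\<close> is an
  arbitrary function.\<close>

lemma functional_realizer: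
  obtains F where "computable_on UNIV (\<lambda>x. x) F"
    and "\<And>G tf T f. realizes G tf (fan T) \<Longrightarrow> (\<And>n. G \<Longrightarrow> holds (T (segment f n))) \<Longrightarrow>
      realizes G (F tf) (functional \<^bold>N \<^bold>N (graph f))"
proof -
  define strict where "strict m = pair_code (bind_code (\<lambda>k. sing (pfst k)) m) (bind_code (\<lambda>k. sing (psnd k)) m)" for m
  have "computable_on UNIV (\<lambda>x. x) strict"
    unfolding strict_def
    by (intro computable_on_code_intros computable_on_context_snd computable_on_self)
  then obtain r1 where r1: "\<And>m. r1 \<bullet> m = Some (strict m)"
    using total_index_exists by metis
  define ext where "ext m = bind_code (\<lambda>a. bind_code (\<lambda>b. sing (npair a b)) (untag 1 (untag 1 m))) (untag 0 (untag 1 m))" for m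
  have "computable_on UNIV (\<lambda>x. x) ext"
    unfolding ext_def
    by (intro computable_on_code_intros computable_on_context_snd computable_on_context_snd'
        computable_on_self computable_on_context_fst)
  then obtain r2 where r2: "\<And>m. r2 \<bullet> m = Some (ext m)"
    using total_index_exists by metis
  \<comment> \<open>Two potential realizers may name different values \<open>y\<close> and
    \<open>y'\<close>. The equation then has only the empty sequence as potential realizer, so
    nothing may be contributed in that case.\<close>
  define uniq where "uniq m = bind_code (\<lambda>k. bind_code (\<lambda>l. if psnd k = psnd l then sing (psnd k) else 0) (untag 1 m)) (untag 0 m)" for m
  have "computable_on UNIV (\<lambda>x. x) uniq"
    unfolding uniq_def
    by (intro computable_on_code_intros computable_on_context_snd computable_on_context_snd'
        computable_on_self computable_on_context_fst)
  then obtain r3 where r3: "\<And>m. r3 \<bullet> m = Some (uniq m)"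
    using total_index_exists by metis
  \<comment> \<open>Every \<open>y\<close> up to the bound for the value at \<open>x\<close> is
    proposed; \<open>f x\<close> is one of them. The inner \<open>sing\<close> builds a realizer of
    one instance, the outer one makes it an entry of a realizer of the existential
    statement.\<close>
  define vals where "vals tf m = bind_code (\<lambda>x. bind_code (\<lambda>y. sing (sing (npair x y))) (upto_code (level tf (Suc x)))) m" for tf m
  have "computable_on {(tf, m). tf \<in> {tf. \<exists>T. realizes False tf (fan T)} \<and> m \<in> UNIV} (\<lambda>(tf, m). npair tf m)
      (\<lambda>p. vals (fst p) (snd p))"
    unfolding vals_def
    by (intro computable_on_code_intros computable_on_context_snd computable_on_context_snd'
        computable_on_level computable_on_weaken[OF computable_on_context_fst[where D="UNIV"]]) auto
  from closure_exists[OF this] obtain c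
    where c: "\<And>tf m T. realizes False tf (fan T) \<Longrightarrow> closure c tf \<bullet> m = Some (vals tf m)"
    by blast
  define F where "F tf = pair_code (sing r1) (pair_code (sing r2) (pair_code (sing r3) (sing (closure c tf))))" for tf
  have "computable_on UNIV (\<lambda>x. x) F"
    unfolding F_def by (intro computable_on_code_intros computable_on_self)
  moreover have "realizes G (F tf) (functional \<^bold>N \<^bold>N (graph f))"
    if tf: "realizes G tf (fan T)" and f: "\<And>n. G \<Longrightarrow> holds (T (segment f n))" for G tf T f
    unfolding functional_def F_def
  proof (intro realizes_pair_code)
    show "realizes G (sing r1) (\<^bold>\<forall>x y. graph f x y \<^bold>\<longrightarrow> exists_in \<^bold>N x \<^bold>\<and> exists_in \<^bold>N y)"
      unfolding realizes_all_iff
    proof (intro allI realizes_impI[OF r1])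
      fix x y H m assume m: "realizes H m (graph f x y)"
      show "realizes H (strict m) (\<^bold>N x x \<^bold>\<and> \<^bold>N y y)"
        unfolding strict_def
        by (intro realizes_pair_code realizes_bind_code)
          (use m in \<open>cases "list_decode m"; fastforce simp: realizes_graph_iff realizes_nat_iff\<close>)+
    qed
    show "realizes G (sing r2) (\<^bold>\<forall>x y x' y'. graph f x y \<^bold>\<and> \<^bold>N x x' \<^bold>\<and> \<^bold>N y y' \<^bold>\<longrightarrow> graph f x' y')"
      unfolding realizes_all_iff
    proof (intro allI realizes_impI[OF r2])
      fix x y x' y' H m assume "realizes H m (graph f x y \<^bold>\<and> \<^bold>N x x' \<^bold>\<and> \<^bold>N y y')"
      note m = realizes_conjD(1)[OF this] realizes_conjD(1)[OF realizes_conjD(2)[OF this]]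
        realizes_conjD(2)[OF realizes_conjD(2)[OF this]]
      show "realizes H (ext m) (graph f x' y')"
        unfolding ext_def
      proof (rule realizes_bind_code)
        show "realizes False (bind_code (\<lambda>b. sing (npair a b)) (untag 1 (untag 1 m))) (graph f x' y')"
          if "a \<in> set (list_decode (untag 0 (untag 1 m)))" for a
          by (rule realizes_bind_code) (use m that in \<open>auto simp: realizes_graph_iff realizes_nat_iff\<close>)
      next
        assume H
        then have "list_decode (untag 0 (untag 1 m)) \<noteq> []" "list_decode (untag 1 (untag 1 m)) \<noteq> []"
          "x = x'" "y = y'" "f x = y"
          using m by (auto simp: realizes_graph_iff realizes_nat_iff)
        then obtain a b where ab: "a \<in> set (list_decode (untag 0 (untag 1 m)))" "b \<in> set (list_decode (untag 1 (untag 1 m)))"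
          by (meson last_in_set)
        then have "realizes True (sing (npair a b)) (graph f x' y')"
          using m \<open>x = x'\<close> \<open>y = y'\<close> \<open>f x = y\<close> by (auto simp: realizes_graph_iff realizes_nat_iff)
        moreover have "realizes False (sing (npair a b')) (graph f x' y')" if "b' \<in> set (list_decode (untag 1 (untag 1 m)))" for b'
          using m ab(1) that by (auto simp: realizes_graph_iff realizes_nat_iff)
        ultimately show "\<exists>a\<in>set (list_decode (untag 0 (untag 1 m))).
            realizes True (bind_code (\<lambda>b. sing (npair a b)) (untag 1 (untag 1 m))) (graph f x' y')"
          using ab by (intro bexI[OF _ ab(1)], intro realizes_bind_code) auto
      qed
    qed
    show "realizes G (sing r3) (\<^bold>\<forall>x y y'. graph f x y \<^bold>\<and> graph f x y' \<^bold>\<longrightarrow> \<^bold>N y y')"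
      unfolding realizes_all_iff
    proof (intro allI realizes_impI[OF r3])
      fix x y y' H m assume "realizes H m (graph f x y \<^bold>\<and> graph f x y')"
      note m = realizes_conjD[OF this]
      have pot: "realizes False (if psnd k = psnd l then sing (psnd k) else 0) (\<^bold>N y y')"
        if "k \<in> set (list_decode (untag 0 m))" "l \<in> set (list_decode (untag 1 m))" for k l
      proof -
        have "k = npair x y" "l = npair x y'"
          using m that unfolding realizes_graph_iff by blast+
        then show ?thesis by (auto simp: realizes_nat_iff)
      qed
      show "realizes H (uniq m) (\<^bold>N y y')"
        unfolding uniq_def
      proof (rule realizes_bind_code)
        show "realizes False (bind_code (\<lambda>l. if psnd k = psnd l then sing (psnd k) else 0) (untag 1 m)) (\<^bold>N y y')"
          if "k \<in> set (list_decode (untag 0 m))" for k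
          by (rule realizes_bind_code) (use pot that in auto)
      next
        assume H
        then have "list_decode (untag 0 m) \<noteq> []" "list_decode (untag 1 m) \<noteq> []" "y = y'"
          using m by (auto simp: realizes_graph_iff)
        then obtain k l where kl: "k \<in> set (list_decode (untag 0 m))" "l \<in> set (list_decode (untag 1 m))"
          by (meson last_in_set)
        then have "k = npair x y" "l = npair x y'"
          using m unfolding realizes_graph_iff by blast+
        then have "realizes True (if psnd k = psnd l then sing (psnd k) else 0) (\<^bold>N y y')"
          using \<open>y = y'\<close> by (simp add: realizes_nat_iff)
        then show "\<exists>k\<in>set (list_decode (untag 0 m)). realizes True
            (bind_code (\<lambda>l. if psnd k = psnd l then sing (psnd k) else 0) (untag 1 m)) (\<^bold>N y y')"
          using kl pot by (intro bexI[OF _ kl(1)], intro realizes_bind_code) blast+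
      qed
    qed
    show "realizes G (sing (closure c tf)) (\<^bold>\<forall>x. exists_in \<^bold>N x \<^bold>\<longrightarrow> (\<^bold>\<exists>y. graph f x y))"
      unfolding realizes_all_iff
    proof (intro allI realizes_impI[OF c[OF realizes_False[OF tf]]])
      fix x H m assume HG: "H \<Longrightarrow> G" and m: "realizes H m (\<^bold>N x x)"
      have pot: "realizes False (sing (npair x y)) (graph f x y)" for y
        by (simp add: realizes_graph_iff)
      show "realizes H (vals tf m) (\<^bold>\<exists>y. graph f x y)"
        unfolding vals_def
      proof (rule realizes_bind_code)
        fix x' assume "x' \<in> set (list_decode m)"
        then have "x' = x" using m by (auto simp: realizes_nat_iff)
        then show "realizes False (bind_code (\<lambda>y. sing (sing (npair x' y))) (upto_code (level tf (Suc x'))))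
            (\<^bold>\<exists>y. graph f x y)"
          by (auto intro: realizes_bind_code realizes_ex_sing[where \<phi>="graph f x", OF pot])
      next
        assume H
        then have G using HG by simp
        have "list_decode m \<noteq> []"
          using m \<open>H\<close> by (auto simp: realizes_nat_iff)
        then have "x \<in> set (list_decode m)"
          using m by (cases "list_decode m") (auto simp: realizes_nat_iff)
        moreover have "realizes True (sing (npair x (f x))) (graph f x (f x))"
          by (simp add: realizes_graph_iff)
        moreover have "f x \<in> set (list_decode (upto_code (level tf (Suc x))))"
          using value_le_level[of tf T f x] tf f \<open>G\<close> by simp
        ultimately show "\<exists>x'\<in>set (list_decode m). realizes True
            (bind_code (\<lambda>y. sing (sing (npair x' y))) (upto_code (level tf (Suc x')))) (\<^bold>\<exists>y. graph f x y)"
          by (intro bexI[of _ x], intro realizes_bind_code) (blast intro: realizes_ex_sing[where \<phi>="graph f x"] pot)+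
      qed
    qed
  qed
  ultimately show ?thesis
    using that by blast
qed


lemma exp_realizer:
  obtains F where "computable_on UNIV (\<lambda>x. x) F"
    and "\<And>G tf T f. realizes G tf (fan T) \<Longrightarrow> (\<And>n. G \<Longrightarrow> holds (T (segment f n))) \<Longrightarrow>
      realizes G (F tf) (exists_in (exp_obj \<^bold>N \<^bold>N) (graph f))"
proof -
  obtain F where F: "computable_on UNIV (\<lambda>x. x) F"
    "\<And>G tf T f. realizes G tf (fan T) \<Longrightarrow> (\<And>n. G \<Longrightarrow> holds (T (segment f n))) \<Longrightarrow>
      realizes G (F tf) (functional \<^bold>N \<^bold>N (graph f))"
    using functional_realizer by metis
  obtain r where r: "\<And>m. r \<bullet> m = Some m"
    using total_index_exists[OF computable_on_self] by blast
  define F' where "F' tf = pair_code (F tf) (pair_code (F tf) (pair_code (sing r) (sing r)))" for tf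
  have "computable_on UNIV (\<lambda>x. x) F'"
    unfolding F'_def by (intro computable_on_code_intros F)
  moreover have "realizes G (F' tf) (exists_in (exp_obj \<^bold>N \<^bold>N) (graph f))"
    if "realizes G tf (fan T)" "\<And>n. G \<Longrightarrow> holds (T (segment f n))" for G tf T f
  proof -
    have "realizes G (sing r) (p \<^bold>\<longrightarrow> p)" for p
      by (rule realizes_impI[OF r])
    then have "realizes G (pair_code (sing r) (sing r)) (\<^bold>\<forall>x y. graph f x y \<^bold>\<longleftrightarrow> graph f x y)"
      by (simp add: realizes_all_iff realizes_pair_code)
    then show ?thesis
      unfolding exp_obj_def F'_def using F(2)[OF that] by (blast intro: realizes_pair_code)
  qed
  ultimately show ?thesis using that by blast
qed

text \<open>\<open>I\<close> copies the entries of \<open>s\<close> as claimed values, which is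
  potentially correct for every \<open>f\<close>. For the actual case, truth of
  \<open>Suc i \<le> n\<close> puts \<open>i\<close> in range, where the entry of \<open>s\<close>
  is \<open>f i\<close>.\<close>

lemma initial_segment_realizer:
  obtains I where "computable_on UNIV (\<lambda>x. x) I"
    and "\<And>G s n f. length (list_decode s) = n \<Longrightarrow> (G \<Longrightarrow> list_decode s = segment f n) \<Longrightarrow>
      realizes G (I s) (is_initial_segment (graph f) n (list_decode s))"
proof -
  have "computable_on UNIV (\<lambda>(x, y). npair x y) (\<lambda>p. sing (fst p))"
    by (intro computable_on_code_intros computable_on_context_fst)
  from total_closure_exists[OF this]
  obtain c where c: "\<And>x y. closure c x \<bullet> y = Some (sing x)" by blast
  define vals where "vals s m = bind_code (\<lambda>i. sing (closure c (npair i (entry_code s i)))) m" for s m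
  have "computable_on UNIV (\<lambda>(x, y). npair x y) (\<lambda>p. vals (fst p) (snd p))"
    unfolding vals_def
    by (intro computable_on_code_intros computable_on_context_snd
        computable_on_weaken[OF computable_on_context_fst[where D=UNIV]]) auto
  from total_closure_exists[OF this]
  obtain d where d: "\<And>s m. closure d s \<bullet> m = Some (vals s m)" by blast
  define I where "I s = pair_code (sing (length (list_decode s))) (sing (closure d s))" for s
  have "computable_on UNIV (\<lambda>x. x) I"
    unfolding I_def by (intro computable_on_code_intros computable_on_self)
  moreover have "realizes G (I s) (is_initial_segment (graph f) n (list_decode s))"
    if n: "length (list_decode s) = n" and s: "G \<Longrightarrow> list_decode s = segment f n" for G s n f
    unfolding is_initial_segment_def I_def n
  proof (rule realizes_pair_code[OF realizes_sing_nat], unfold realizes_All_in_iff, intro allI realizes_impI[OF d])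
    fix i H m assume HG: "H \<Longrightarrow> G" and m: "realizes H m (\<^bold>N i i)"
    have *: "realizes H (sing (closure c (npair i (entry_code s i))))
        (le_nat (Suc i) n \<^bold>\<longrightarrow> graph f i (entry (list_decode s) i))"
    proof (rule realizes_impI[OF c])
      fix K k assume "K \<Longrightarrow> H" "realizes K k (le_nat (Suc i) n)"
      then show "realizes K (sing (npair i (entry_code s i))) (graph f i (entry (list_decode s) i))"
        using s HG holds_if_realizes[of K k "le_nat (Suc i) n"]
        by (auto simp: realizes_graph_iff entry_code holds_le_nat_iff entry_def segment_def)
    qed
    show "realizes H (vals s m) (le_nat (Suc i) n \<^bold>\<longrightarrow> graph f i (entry (list_decode s) i))"
      unfolding vals_def
    proof (rule realizes_bind_code)
      fix j assume "j \<in> set (list_decode m)"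
      then show "realizes False (sing (closure c (npair j (entry_code s j))))
          (le_nat (Suc i) n \<^bold>\<longrightarrow> graph f i (entry (list_decode s) i))"
        using m realizes_False[OF *] by (simp add: realizes_nat_iff)
    next
      assume H
      then have "i \<in> set (list_decode m)"
        using m by (cases "list_decode m") (auto simp: realizes_nat_iff)
      then show "\<exists>j\<in>set (list_decode m). realizes True (sing (closure c (npair j (entry_code s j))))
          (le_nat (Suc i) n \<^bold>\<longrightarrow> graph f i (entry (list_decode s) i))"
        using * \<open>H\<close> by auto
    qed
  qed
  ultimately show ?thesis using that by blast
qed

text \<open>All candidates of length \<open>n\<close> are offered as the initial segment, each with
  \<open>node\<close> as its claimed realizer of membership. The claim is actually correct for the
  one candidate that is the segment of \<open>f\<close>.\<close>

lemma path_realizer: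
  obtains F where "computable_on UNIV (\<lambda>x. x) F"
    and "\<And>G tf T f. realizes G tf (fan T) \<Longrightarrow> (\<And>n. G \<Longrightarrow> holds (T (segment f n))) \<Longrightarrow>
      realizes G (F tf) (infinite_path T (graph f))"
proof -
  obtain I where I: "computable_on UNIV (\<lambda>x. x) I"
    "\<And>G s n f. length (list_decode s) = n \<Longrightarrow> (G \<Longrightarrow> list_decode s = segment f n) \<Longrightarrow>
      realizes G (I s) (is_initial_segment (graph f) n (list_decode s))"
    using initial_segment_realizer by metis
  define item where "item tf s = pair_code (sing s) (pair_code (I s) (node tf s))" for tf s
  define segs where "segs tf m = bind_code (\<lambda>n. bind_code (\<lambda>s. sing (item tf s)) (level tf n)) m" for tf m
  note I' = computable_on_comp[OF I(1), where p="\<lambda>p. snd p", OF computable_on_context_snd UNIV_I]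
  have "computable_on {(tf, m). tf \<in> {tf. \<exists>T. realizes False tf (fan T)} \<and> m \<in> UNIV} (\<lambda>(tf, m). npair tf m)
      (\<lambda>p. segs (fst p) (snd p))"
    unfolding segs_def item_def
    by (intro computable_on_code_intros computable_on_context_snd I' computable_on_node
        computable_on_level computable_on_weaken[OF computable_on_weaken[OF computable_on_context_fst[where D=UNIV], OF UNIV_I, where D'=UNIV]]
        computable_on_weaken[OF computable_on_context_fst[where D=UNIV], OF UNIV_I] UNIV_I) auto
  from closure_exists[OF this] obtain c
    where c: "\<And>tf m T. realizes False tf (fan T) \<Longrightarrow> closure c tf \<bullet> m = Some (segs tf m)"
    by blast
  have "computable_on UNIV (\<lambda>x. x) (\<lambda>tf. sing (closure c tf))"
    by (intro computable_on_code_intros computable_on_self)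
  moreover have "realizes G (sing (closure c tf)) (infinite_path T (graph f))"
    if tf: "realizes G tf (fan T)" and f: "\<And>n. G \<Longrightarrow> holds (T (segment f n))" for G tf T f
    unfolding infinite_path_def realizes_All_in_iff
  proof (intro allI realizes_impI[OF c[OF realizes_False[OF tf]]])
    fix n H m assume HG: "H \<Longrightarrow> G" and m: "realizes H m (\<^bold>N n n)"
    have item: "realizes (G \<and> list_decode s = segment f n) (sing (item tf s)) (at_segment T (graph f) n)"
      if "s \<in> set (list_decode (level tf n))" for s
    proof -
      have "realizes (G \<and> list_decode s = segment f n) (item tf s)
          (exists_in \<^bold>S (list_decode s) \<^bold>\<and> is_initial_segment (graph f) n (list_decode s) \<^bold>\<and> T (list_decode s))"
        unfolding item_def
        by (intro realizes_pair_code realizes_sing_seq I(2) realizes_weaken[OF realizes_node[OF tf]])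
          (use that f length_level in auto)
      then show ?thesis
        unfolding at_segment_def Ex_in_def by (rule realizes_ex_sing)
    qed
    have pot: "realizes False (bind_code (\<lambda>s. sing (item tf s)) (level tf n)) (at_segment T (graph f) n)"
      by (rule realizes_bind_code) (use realizes_False[OF item] in auto)
    show "realizes H (segs tf m) (at_segment T (graph f) n)"
      unfolding segs_def
    proof (rule realizes_bind_code)
      fix k assume "k \<in> set (list_decode m)"
      then show "realizes False (bind_code (\<lambda>s. sing (item tf s)) (level tf k)) (at_segment T (graph f) n)"
        using m pot by (simp add: realizes_nat_iff)
    next
      assume H
      then have "n \<in> set (list_decode m)"
        using m by (cases "list_decode m") (auto simp: realizes_nat_iff)
      moreover have "realizes True (bind_code (\<lambda>s. sing (item tf s)) (level tf n)) (at_segment T (graph f) n)"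
      proof (rule realizes_bind_code)
        have "list_encode (segment f n) \<in> set (list_decode (level tf n))"
          using segment_in_level[of tf T f n] tf f HG \<open>H\<close> by simp
        then show "\<exists>s\<in>set (list_decode (level tf n)). realizes True (sing (item tf s)) (at_segment T (graph f) n)"
          using item[of "list_encode (segment f n)"] HG \<open>H\<close> by auto
      qed (use realizes_False[OF item] in auto)
      ultimately show "\<exists>k\<in>set (list_decode m).
          realizes True (bind_code (\<lambda>s. sing (item tf s)) (level tf k)) (at_segment T (graph f) n)"
        by blast
    qed
  qed
  ultimately show ?thesis using that by blast
qed


section \<open>Extending realizers along paths\<close>

text \<open>Serves both for the graph of a classical path and for an internal path: all that matters
  is that every true value of \<alpha> is the value of \<open>f\<close>.\<close>

lemma holds_initial_segmentD:
  assumes "holds (is_initial_segment \<alpha> n s)" "\<And>x y. holds (\<alpha> x y) \<Longrightarrow> f x = y"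
  shows "s = segment f n"
proof (rule nth_equalityI)
  have 1: "holds (\<^bold>N (length s) n)" "holds (\<^bold>\<forall>i\<^bold>\<in>\<^bold>N. le_nat (Suc i) n \<^bold>\<longrightarrow> \<alpha> i (entry s i))"
    using holds_conjD[OF assms(1)[unfolded is_initial_segment_def]] by auto
  then show "length s = length (segment f n)"
    by (simp add: holds_nat_iff)
  show "s ! i = segment f n ! i" if "i < length s" for i
  proof -
    have "holds (le_nat (Suc i) n)"
      using that 1(1) by (simp add: holds_nat_iff holds_le_nat_iff)
    then have "holds (\<alpha> i (entry s i))"
      using holds_impD[OF holds_All_in_natD[OF 1(2), of i]] by simp
    then show ?thesis
      using assms(2) that 1(1) by (fastforce simp: entry_def segment_def holds_nat_iff)
  qed
qed

text \<open>
  From a realizer \<open>g\<close> of the existence of \<open>n\<close> such that \<open>A\<close> holds of the first \<open>n\<close>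
  values of a path, \<open>select g s\<close> collects all that \<open>g\<close> offers as a realizer of \<open>A s\<close>, for
  whatever \<open>n\<close>.
\<close>

definition select :: "nat \<Rightarrow> nat \<Rightarrow> nat"
  where "select g s = bind_code (\<lambda>c. bind_code (\<lambda>d. bind_code
    (\<lambda>u. if u = s then untag 1 (untag 1 d) else 0) (untag 0 d)) (untag 1 c)) g"

lemma computable_on_select:
  assumes "computable_on D e f" "computable_on D e g"
  shows "computable_on D e (\<lambda>z. select (f z) (g z))"
proof -
  have 1: "computable_on D e (\<lambda>z. bind_code (\<lambda>u. if u = g z then untag 1 (untag 1 (f z)) else 0) (untag 0 (f z)))"
    if "computable_on D e f" "computable_on D e g" for D :: "'x set" and e f g
    by (intro computable_on_code_intros computable_on_context_snd computable_on_weaken[OF that(1)]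
        computable_on_weaken[OF that(2)] that) auto
  show ?thesis
    unfolding select_def
    by (intro computable_on_bind_code computable_on_untag 1 assms(1) computable_on_context_snd
        computable_on_weaken[OF computable_on_weaken[OF assms(2), where D'="{p. fst p \<in> D}"]]) auto
qed

text \<open>The witness of the existential quantifier need not be guessed: any entry
  \<open>u\<close> of the realizer of its existence is its code.\<close>

lemma realizes_at_segmentD:
  assumes "realizes G n (at_segment A \<alpha> k)"
  shows "d \<in> set (list_decode n) \<Longrightarrow> u \<in> set (list_decode (untag 0 d)) \<Longrightarrow>
      realizes False (untag 1 (untag 1 d)) (A (list_decode u)) \<and>
      realizes False (untag 0 (untag 1 d)) (is_initial_segment \<alpha> k (list_decode u))"
    and "G \<Longrightarrow> \<exists>d\<in>set (list_decode n). \<exists>u\<in>set (list_decode (untag 0 d)).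
      realizes True (untag 1 (untag 1 d)) (A (list_decode u)) \<and>
      realizes True (untag 0 (untag 1 d)) (is_initial_segment \<alpha> k (list_decode u))"
proof -
  have *: "realizes H (untag 1 (untag 1 d)) (A (list_decode u)) \<and>
      realizes H (untag 0 (untag 1 d)) (is_initial_segment \<alpha> k (list_decode u))"
    if d: "realizes H d (exists_in \<^bold>S s \<^bold>\<and> is_initial_segment \<alpha> k s \<^bold>\<and> A s)"
      and u: "u \<in> set (list_decode (untag 0 d))" for H d u s
  proof -
    have "list_decode u = s"
      using realizes_conjD(1)[OF d] u by (auto simp: realizes_seq_iff)
    then show ?thesis
      using realizes_conjD[OF realizes_conjD(2)[OF d]] by simp
  qed
  note ex = realizes_exD[OF assms[unfolded at_segment_def Ex_in_def]]
  show "realizes False (untag 1 (untag 1 d)) (A (list_decode u)) \<and>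
      realizes False (untag 0 (untag 1 d)) (is_initial_segment \<alpha> k (list_decode u))"
    if "d \<in> set (list_decode n)" "u \<in> set (list_decode (untag 0 d))"
    using ex(1)[OF that(1)] * that(2) by blast
  assume G
  then obtain d s where d: "d \<in> set (list_decode n)"
    "realizes True d (exists_in \<^bold>S s \<^bold>\<and> is_initial_segment \<alpha> k s \<^bold>\<and> A s)"
    using ex(2) by blast
  then have "list_decode (untag 0 d) \<noteq> []"
    using realizes_conjD(1)[OF d(2)] by (simp add: realizes_seq_iff)
  then obtain u where "u \<in> set (list_decode (untag 0 d))"
    by (meson last_in_set)
  then show "\<exists>d\<in>set (list_decode n). \<exists>u\<in>set (list_decode (untag 0 d)).
      realizes True (untag 1 (untag 1 d)) (A (list_decode u)) \<and>
      realizes True (untag 0 (untag 1 d)) (is_initial_segment \<alpha> k (list_decode u))"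
    using * d by blast
qed

text \<open>The comparison of codes in \<open>select\<close> is what keeps it potentially correct at
  every \<open>s\<close>, since realizers offered for another sequence need not even be potential
  ones for \<open>s\<close>. The bound \<open>n \<le> g\<close> holds because the right
  \<open>n\<close> occurs, tagged, in an entry of \<open>g\<close>.\<close>

lemma realizes_select:
  assumes g: "realizes G g (\<^bold>\<exists>n\<^bold>\<in>\<^bold>N. at_segment A \<alpha> n)"
  shows "realizes False (select g s) (A (list_decode s))"
    and "G \<Longrightarrow> (\<And>x y. holds (\<alpha> x y) \<Longrightarrow> f x = y) \<Longrightarrow>
      \<exists>n\<le>g. realizes True (select g (list_encode (segment f n))) (A (segment f n))"
proof -
  note ex = realizes_exD[OF g[unfolded Ex_in_def]]
  have 1: "realizes False (if u = s then untag 1 (untag 1 d) else 0) (A (list_decode s))"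
    if cdu: "c \<in> set (list_decode g)" "d \<in> set (list_decode (untag 1 c))"
      "u \<in> set (list_decode (untag 0 d))"
    for c d u s
  proof -
    obtain n where "realizes False c (exists_in \<^bold>N n \<^bold>\<and> at_segment A \<alpha> n)"
      using ex(1)[OF cdu(1)] by blast
    from realizes_at_segmentD(1)[OF realizes_conjD(2)[OF this] cdu(2,3)] show ?thesis
      using realizes_empty by auto
  qed
  have 2: "realizes False (bind_code (\<lambda>u. if u = s then untag 1 (untag 1 d) else 0) (untag 0 d)) (A (list_decode s))"
    if "c \<in> set (list_decode g)" "d \<in> set (list_decode (untag 1 c))" for c d s
    by (rule realizes_bind_code) (use 1[OF that] in auto)
  have 3: "realizes False (bind_code (\<lambda>d. bind_code
      (\<lambda>u. if u = s then untag 1 (untag 1 d) else 0) (untag 0 d)) (untag 1 c)) (A (list_decode s))"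
    if "c \<in> set (list_decode g)" for c s
    by (rule realizes_bind_code) (use 2[OF that] in auto)
  show "realizes False (select g s) (A (list_decode s))"
    unfolding select_def by (rule realizes_bind_code) (use 3 in auto)
  assume G and f: "\<And>x y. holds (\<alpha> x y) \<Longrightarrow> f x = y"
  obtain c n where c: "c \<in> set (list_decode g)" "realizes True c (exists_in \<^bold>N n \<^bold>\<and> at_segment A \<alpha> n)"
    using ex(2)[OF \<open>G\<close>] by blast
  have "n \<in> set (list_decode (untag 0 c))"
    using realizes_conjD(1)[OF c(2)] by (cases "list_decode (untag 0 c)") (auto simp: realizes_nat_iff)
  then have "n \<le> g"
    using tagged_le_code entry_le_code[OF c(1)] by (meson order_trans)
  obtain d u where d: "d \<in> set (list_decode (untag 1 c))" and u: "u \<in> set (list_decode (untag 0 d))"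
    and A: "realizes True (untag 1 (untag 1 d)) (A (list_decode u))"
    and seg: "realizes True (untag 0 (untag 1 d)) (is_initial_segment \<alpha> n (list_decode u))"
    using realizes_at_segmentD(2)[OF realizes_conjD(2)[OF c(2)]] by blast
  have eq: "list_decode u = segment f n"
    using holds_initial_segmentD[OF holds_if_realizes[OF seg]] f by blast
  have "realizes True (bind_code (\<lambda>v. if v = u then untag 1 (untag 1 d) else 0) (untag 0 d)) (A (list_decode u))"
    by (rule realizes_bind_code) (use 1[OF c(1) d, of _ u] A u in auto)
  then have "realizes True (bind_code (\<lambda>d. bind_code
      (\<lambda>v. if v = u then untag 1 (untag 1 d) else 0) (untag 0 d)) (untag 1 c)) (A (list_decode u))"
    by - (rule realizes_bind_code, erule 2[OF c(1)], rule bexI[OF _ d])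
  then have "realizes True (select g u) (A (list_decode u))"
    unfolding select_def by - (rule realizes_bind_code, erule 3, rule bexI[OF _ c(1)])
  moreover have "list_encode (segment f n) = u"
    by (simp flip: eq)
  ultimately show "\<exists>n\<le>g. realizes True (select g (list_encode (segment f n))) (A (segment f n))"
    using \<open>n \<le> g\<close> eq by (intro exI[of _ n]) simp
qed

text \<open>The state consists of the part of the sequence that has been read and a realizer for it.\<close>

definition extend_step :: "nat \<Rightarrow> nat \<Rightarrow> nat \<Rightarrow> nat \<Rightarrow> nat \<Rightarrow> nat"
  where "extend_step tf inh g y x = npair (snoc (pfst y) x)
    (append_code
      (ap (ap (ap inh (sing (pfst y))) (sing x)) (pair_code (psnd y) (node tf (snoc (pfst y) x))))
      (select g (snoc (pfst y) x)))"

definition extend :: "nat \<Rightarrow> nat \<Rightarrow> nat \<Rightarrow> nat list \<Rightarrow> nat"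
  where "extend tf inh g s = foldl (extend_step tf inh g) (npair 0 (select g 0)) s"

lemma pfst_extend [simp]: "pfst (extend tf inh g s) = list_encode s"
  by (induction s rule: rev_induct) (simp_all add: extend_def extend_step_def list_encode_snoc)

section \<open>Correctness of the extended realizers\<close>

lemma realizes_inherited_step:
  assumes "realizes G inh (inherited T A)"
  shows "realizes G (ap (ap inh (sing (list_encode s))) (sing x)) (A s \<^bold>\<and> T (s @ [x]) \<^bold>\<longrightarrow> A (s @ [x]))"
proof -
  have "realizes G inh (exists_in \<^bold>S s \<^bold>\<longrightarrow> (\<^bold>\<forall>x\<^bold>\<in>\<^bold>N. A s \<^bold>\<and> T (s @ [x]) \<^bold>\<longrightarrow> A (s @ [x])))"
    using assms by (simp add: inherited_def realizes_All_in_iff)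
  then have "realizes G (ap inh (sing (list_encode s))) (\<^bold>\<forall>x\<^bold>\<in>\<^bold>N. A s \<^bold>\<and> T (s @ [x]) \<^bold>\<longrightarrow> A (s @ [x]))"
    by (rule realizes_ap) (use realizes_sing_seq[of G "list_encode s"] in simp)
  then show ?thesis
    unfolding realizes_All_in_iff by (blast intro: realizes_ap realizes_sing_nat)
qed

lemma extend_snoc:
  "psnd (extend tf inh g (s @ [x])) = append_code
    (ap (ap (ap inh (sing (list_encode s))) (sing x))
      (pair_code (psnd (extend tf inh g s)) (node tf (list_encode (s @ [x])))))
    (select g (list_encode (s @ [x])))"
  using pfst_extend[of tf inh g s] by (simp add: extend_def extend_step_def list_encode_snoc)

text \<open>Potential correctness holds at every sequence, also off the tree, because
  \<open>node\<close> always yields a potential realizer of membership and inheritance converges on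
  it.\<close>

lemma realizes_extend:
  assumes tf: "realizes G tf (fan T)" and inh: "realizes G inh (inherited T A)"
    and g: "\<And>s. realizes False (select g s) (A (list_decode s))"
  shows "realizes False (psnd (extend tf inh g s)) (A s)"
proof (induction s rule: rev_induct)
  case Nil
  show ?case using g[of 0] by (simp add: extend_def)
next
  case (snoc x s)
  have "realizes False (node tf (list_encode (s @ [x]))) (T (s @ [x]))"
    using realizes_False[OF realizes_node[OF tf, of "list_encode (s @ [x])"]] by simp
  then have "realizes False (ap (ap (ap inh (sing (list_encode s))) (sing x))
      (pair_code (psnd (extend tf inh g s)) (node tf (list_encode (s @ [x]))))) (A (s @ [x]))"
    by (intro realizes_ap[OF realizes_inherited_step[OF realizes_False[OF inh]]] realizes_pair_code snoc.IH)
  moreover have "realizes False (select g (list_encode (s @ [x]))) (A (s @ [x]))"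
    using g[of "list_encode (s @ [x])"] by simp
  ultimately show ?case
    using realizes_append_code[of False _ "A (s @ [x])" False] by (simp add: extend_snoc)
qed

text \<open>At length \<open>n\<close> the half coming from \<open>select\<close> is actual while
  the inherited half is known only to be potential; beyond \<open>n\<close> the roles are exchanged.
  Concatenating the halves preserves whichever is actual. Length 0 is separate because the initial
  state has no predecessor.\<close>

lemma realizes_extend_segment:
  assumes tf: "realizes True tf (fan T)" and inh: "realizes True inh (inherited T A)"
    and g: "\<And>s. realizes False (select g s) (A (list_decode s))"
    and f: "\<And>n. holds (T (segment f n))"
    and "n \<le> m" and n: "realizes True (select g (list_encode (segment f n))) (A (segment f n))"
  shows "realizes True (psnd (extend tf inh g (segment f m))) (A (segment f m))"
  using \<open>n \<le> m\<close>
proof (induction m rule: dec_induct)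
  case base
  show ?case
  proof (cases n)
    case 0
    then show ?thesis using n by (simp add: extend_def)
  next
    case (Suc k)
    have "realizes False (node tf (list_encode (segment f n))) (T (segment f n))"
      using realizes_False[OF realizes_node[OF tf, of "list_encode (segment f n)"]] by simp
    then have "realizes False (ap (ap (ap inh (sing (list_encode (segment f k)))) (sing (f k)))
        (pair_code (psnd (extend tf inh g (segment f k))) (node tf (list_encode (segment f n))))) (A (segment f n))"
      unfolding Suc segment_simps
      by (intro realizes_ap[OF realizes_inherited_step[OF realizes_False[OF inh]]] realizes_pair_code
          realizes_extend[OF tf inh g])
    from realizes_append_code[OF this n] show ?thesis
      by (simp add: Suc extend_snoc)
  qed
next
  case (step k)
  let ?s = "segment f (Suc k)"
  have "realizes True (node tf (list_encode ?s)) (T ?s)"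
    using realizes_node[OF tf, of "list_encode ?s"] f[of "Suc k"] by simp
  then have "realizes True (ap (ap (ap inh (sing (list_encode (segment f k)))) (sing (f k)))
      (pair_code (psnd (extend tf inh g (segment f k))) (node tf (list_encode ?s)))) (A ?s)"
    unfolding segment_simps
    by (intro realizes_ap[OF realizes_inherited_step[OF inh]] realizes_pair_code step.IH)
  moreover have "realizes False (select g (list_encode ?s)) (A ?s)"
    using g[of "list_encode ?s"] by simp
  ultimately have "realizes True (append_code (ap (ap (ap inh (sing (list_encode (segment f k)))) (sing (f k)))
      (pair_code (psnd (extend tf inh g (segment f k))) (node tf (list_encode ?s)))) (select g (list_encode ?s))) (A ?s)"
    using realizes_append_code[of True _ "A ?s" False] by simp
  then show ?case
    by (simp add: extend_snoc)
qed

text \<open>The condition on the state \<open>y\<close> is the invariant of the fold: it pairs the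
  code of what has been read with a potential realizer of \<open>A\<close> there, which makes all
  the applications converge.\<close>

lemma computable_on_extend_step:
  assumes "computable_on D e tf" "computable_on D e inh" "computable_on D e g"
    and "computable_on D e y" "computable_on D e x"
    and ok: "\<And>z. z \<in> D \<Longrightarrow> \<exists>T A us. realizes False (tf z) (fan T) \<and> realizes False (inh z) (inherited T A) \<and>
      pfst (y z) = list_encode us \<and> realizes False (psnd (y z)) (A us)"
  shows "computable_on D e (\<lambda>z. extend_step (tf z) (inh z) (g z) (y z) (x z))"
  unfolding extend_step_def
proof (intro computable_on_ap computable_on_code_intros computable_on_select computable_on_node assms(1-5))
  fix z assume "z \<in> D"
  then obtain T A us where T: "realizes False (tf z) (fan T)" "realizes False (inh z) (inherited T A)"
    and y: "pfst (y z) = list_encode us" "realizes False (psnd (y z)) (A us)"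
    using ok by blast
  show "\<exists>T. realizes False (tf z) (fan T)"
    using T by auto
  have 1: "realizes False (inh z) (exists_in \<^bold>S us \<^bold>\<longrightarrow> (\<^bold>\<forall>x\<^bold>\<in>\<^bold>N. A us \<^bold>\<and> T (us @ [x]) \<^bold>\<longrightarrow> A (us @ [x])))"
    using T(2) by (simp add: inherited_def realizes_All_in_iff)
  have 2: "realizes False (sing (pfst (y z))) (exists_in \<^bold>S us)"
    using realizes_sing_seq[of False "list_encode us"] by (simp add: y)
  show "\<exists>p q. realizes False (inh z) (p \<^bold>\<longrightarrow> q) \<and> realizes False (sing (pfst (y z))) p"
    using 1 2 by blast
  have 3: "realizes False (ap (inh z) (sing (pfst (y z))))
      (exists_in \<^bold>N (x z) \<^bold>\<longrightarrow> (A us \<^bold>\<and> T (us @ [x z]) \<^bold>\<longrightarrow> A (us @ [x z])))"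
    using realizes_ap[OF 1 2] unfolding realizes_All_in_iff by blast
  then show "\<exists>p q. realizes False (ap (inh z) (sing (pfst (y z)))) (p \<^bold>\<longrightarrow> q) \<and> realizes False (sing (x z)) p"
    using realizes_sing_nat by blast
  have "realizes False (pair_code (psnd (y z)) (node (tf z) (snoc (pfst (y z)) (x z)))) (A us \<^bold>\<and> T (us @ [x z]))"
    using realizes_False[OF realizes_node[OF T(1), of "snoc (pfst (y z)) (x z)"]]
    by (intro realizes_pair_code y) (simp add: y)
  then show "\<exists>p q. realizes False (ap (ap (inh z) (sing (pfst (y z)))) (sing (x z))) (p \<^bold>\<longrightarrow> q) \<and>
      realizes False (pair_code (psnd (y z)) (node (tf z) (snoc (pfst (y z)) (x z)))) p"
    using realizes_ap[OF 3 realizes_sing_nat] by blast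
qed

lemma computable_on_extend:
  assumes tf: "computable_on D e tf" and inh: "computable_on D e inh" and g: "computable_on D e g"
    and s: "computable_on D e s"
    and ok: "\<And>z. z \<in> D \<Longrightarrow> \<exists>T A. realizes False (tf z) (fan T) \<and> realizes False (inh z) (inherited T A) \<and>
      (\<forall>s. realizes False (select (g z) s) (A (list_decode s)))"
  shows "computable_on D e (\<lambda>z. extend (tf z) (inh z) (g z) (list_decode (s z)))"
  unfolding extend_def
proof (rule computable_on_foldl[OF s])
  show "computable_on D e (\<lambda>z. npair 0 (select (g z) 0))"
    by (intro computable_on_intros computable_on_select g)
  let ?D = "{(z, y, x). z \<in> D \<and> (\<exists>us vs. list_decode (s z) = us @ x # vs \<and>
      y = foldl (extend_step (tf z) (inh z) (g z)) (npair 0 (select (g z) 0)) us)}"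
    and ?e = "\<lambda>(z, y, x). npair (e z) (npair y x)"
  have D: "fst p \<in> D" if "p \<in> ?D" for p using that by auto
  have "computable_on ?D ?e (\<lambda>p. extend_step (tf (fst p)) (inh (fst p)) (g (fst p)) (fst (snd p)) (snd (snd p)))"
  proof (intro computable_on_extend_step
      computable_on_weaken2[OF tf] computable_on_weaken2[OF inh] computable_on_weaken2[OF g] D
      computable_on_context_mid computable_on_context_last)
    fix p assume "p \<in> ?D"
    then obtain z y x us where p: "p = (z, y, x)" "z \<in> D" "y = extend (tf z) (inh z) (g z) us"
      by (auto simp: extend_def)
    obtain T A where T: "realizes False (tf z) (fan T)" "realizes False (inh z) (inherited T A)"
      "\<And>s. realizes False (select (g z) s) (A (list_decode s))"
      using ok[OF p(2)] by blast
    show "\<exists>T A us. realizes False (tf (fst p)) (fan T) \<and> realizes False (inh (fst p)) (inherited T A) \<and>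
        pfst (fst (snd p)) = list_encode us \<and> realizes False (psnd (fst (snd p))) (A us)"
      using T realizes_extend[OF T, of us] by (intro exI[of _ T] exI[of _ A] exI[of _ us]) (simp add: p)
  qed
  then show "computable_on ?D ?e (\<lambda>(z, y, x). extend_step (tf z) (inh z) (g z) y x)"
    by (rule computable_on_cong) auto
qed


section \<open>The Fan Theorem\<close>

lemma functional_unique:
  assumes "holds (functional \<^bold>N \<^bold>N \<alpha>)" "holds (\<alpha> x y)" "holds (\<alpha> x y')"
  shows "y = y'"
proof -
  have "holds (\<^bold>\<forall>x y y'. \<alpha> x y \<^bold>\<and> \<alpha> x y' \<^bold>\<longrightarrow> \<^bold>N y y')"
    using assms(1) unfolding functional_def by (blast dest: holds_conjD)
  then have "holds (\<alpha> x y \<^bold>\<and> \<alpha> x y' \<^bold>\<longrightarrow> \<^bold>N y y')"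
    by (auto simp: holds_iff realizes_all_iff)
  then show ?thesis
    using assms(2,3) holds_conjI holds_impD holds_nat_iff by blast
qed

text \<open>\<open>f\<close> is chosen without any effectivity. This does no harm, since
  \<open>f\<close> appears only in the verification and no program has to compute it.\<close>

lemma classical_path:
  assumes "holds (exists_in (exp_obj \<^bold>N \<^bold>N) \<alpha>)" "holds (infinite_path T \<alpha>)"
  obtains f where "\<And>x y. holds (\<alpha> x y) \<Longrightarrow> f x = y" "\<And>n. holds (T (segment f n))"
proof
  define f where "f x = (SOME y. holds (\<alpha> x y))" for x
  have "holds (functional \<^bold>N \<^bold>N \<alpha>)"
    using assms(1) unfolding exp_obj_def by (blast dest: holds_conjD)
  then show f: "f x = y" if "holds (\<alpha> x y)" for x y
    using functional_unique someI[of "\<lambda>y. holds (\<alpha> x y)" y] that unfolding f_def by blast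
  show "holds (T (segment f n))" for n
  proof -
    from holds_exD[OF holds_All_in_natD[OF assms(2)[unfolded infinite_path_def at_segment_def Ex_in_def]], of n]
    obtain s where "holds (exists_in \<^bold>S s \<^bold>\<and> is_initial_segment \<alpha> n s \<^bold>\<and> T s)"
      by blast
    then have s: "holds (is_initial_segment \<alpha> n s)" "holds (T s)"
      by (auto dest!: holds_conjD)
    have "s = segment f n"
      by (rule holds_initial_segmentD[OF s(1) f])
    with s(2) show ?thesis by simp
  qed
qed

abbreviation barred :: "(nat list \<Rightarrow> hprop) \<Rightarrow> (nat list \<Rightarrow> hprop) \<Rightarrow> hprop"
  where "barred T A \<equiv>
    (\<^bold>\<forall>\<alpha>\<^bold>\<in>exp_obj \<^bold>N \<^bold>N. infinite_path T \<alpha> \<^bold>\<longrightarrow> (\<^bold>\<exists>n\<^bold>\<in>\<^bold>N. at_segment A \<alpha> n))"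

text \<open>
  Replaces membership in the tree by \<open>A\<close> in what the path realizer \<open>m\<close> yields at \<open>g\<close>.
\<close>

definition transfer_segments :: "nat \<Rightarrow> nat \<Rightarrow> nat \<Rightarrow> nat \<Rightarrow> nat"
  where "transfer_segments tf inh g m = bind_code (\<lambda>d. bind_code (\<lambda>s. sing (pair_code (sing s)
    (pair_code (untag 0 (untag 1 d)) (psnd (extend tf inh g (list_decode s)))))) (untag 0 d)) (ap m (sing g))"

text \<open>The evidence that \<open>s\<close> is an initial segment of \<alpha> has to come from
  the given realizer for \<alpha>, since \<alpha> is an arbitrary internal path. Only the last
  component is replaced, the realizer of membership in the tree giving way to one of
  \<open>A s\<close>.\<close>

lemma realizes_transfer_segments:
  assumes m: "realizes H m (infinite_path T \<alpha>)"
    and ext: "\<And>s. realizes False (psnd (extend tf inh g s)) (A s)"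
    and act: "\<And>s. H \<Longrightarrow> holds (is_initial_segment \<alpha> g s) \<Longrightarrow> realizes True (psnd (extend tf inh g s)) (A s)"
  shows "realizes H (transfer_segments tf inh g m) (at_segment A \<alpha> g)"
proof -
  have "realizes H (ap m (sing g)) (at_segment T \<alpha> g)"
    using m realizes_ap[OF _ realizes_sing_nat] by (simp add: infinite_path_def realizes_All_in_iff)
  note ex = realizes_exD[OF this[unfolded at_segment_def Ex_in_def]]
  let ?item = "\<lambda>d s. sing (pair_code (sing s) (pair_code (untag 0 (untag 1 d)) (psnd (extend tf inh g (list_decode s)))))"
  have item: "realizes K (?item d u) (at_segment A \<alpha> g)"
    if d: "realizes K d (exists_in \<^bold>S s \<^bold>\<and> is_initial_segment \<alpha> g s \<^bold>\<and> T s)"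
      and u: "u \<in> set (list_decode (untag 0 d))" and K: "K \<Longrightarrow> H" for K d s u
  proof -
    have s: "list_decode u = s"
      using realizes_conjD(1)[OF d] u by (auto simp: realizes_seq_iff)
    have seg: "realizes K (untag 0 (untag 1 d)) (is_initial_segment \<alpha> g s)"
      by (rule realizes_conjD(1)[OF realizes_conjD(2)[OF d]])
    have "realizes K (psnd (extend tf inh g s)) (A s)"
      using ext[of s] act[OF K holds_if_realizes[OF seg]] by (cases K) auto
    with seg have "realizes K (pair_code (sing u) (pair_code (untag 0 (untag 1 d)) (psnd (extend tf inh g (list_decode u)))))
        (exists_in \<^bold>S s \<^bold>\<and> is_initial_segment \<alpha> g s \<^bold>\<and> A s)"
      using realizes_sing_seq[of K u] unfolding s by (intro realizes_pair_code)
    then show ?thesis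
      unfolding at_segment_def Ex_in_def by (rule realizes_ex_sing)
  qed
  have pot: "realizes False (bind_code (?item d) (untag 0 d)) (at_segment A \<alpha> g)"
    if d: "d \<in> set (list_decode (ap m (sing g)))" for d
  proof (rule realizes_bind_code)
    fix u assume "u \<in> set (list_decode (untag 0 d))"
    then show "realizes False (?item d u) (at_segment A \<alpha> g)"
      using ex(1)[OF d] item[of False d _ u] by blast
  qed simp
  show ?thesis
    unfolding transfer_segments_def
  proof (rule realizes_bind_code)
    assume H
    then obtain d s where d: "d \<in> set (list_decode (ap m (sing g)))"
      "realizes True d (exists_in \<^bold>S s \<^bold>\<and> is_initial_segment \<alpha> g s \<^bold>\<and> T s)"
      using ex(2) by blast
    have "realizes True (bind_code (?item d) (untag 0 d)) (at_segment A \<alpha> g)"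
    proof (rule realizes_bind_code)
      show "realizes False (?item d u) (at_segment A \<alpha> g)" if "u \<in> set (list_decode (untag 0 d))" for u
        using item[OF realizes_False[OF d(2)] that] by simp
      have "list_decode (untag 0 d) \<noteq> []"
        using realizes_conjD(1)[OF d(2)] by (simp add: realizes_seq_iff)
      then obtain u where u: "u \<in> set (list_decode (untag 0 d))"
        by (meson last_in_set)
      then have "realizes True (?item d u) (at_segment A \<alpha> g)"
        using item[OF d(2)] \<open>H\<close> by blast
      then show "\<exists>u\<in>set (list_decode (untag 0 d)). realizes True (?item d u) (at_segment A \<alpha> g)"
        using u by blast
    qed
    then show "\<exists>d\<in>set (list_decode (ap m (sing g))).
        realizes True (bind_code (?item d) (untag 0 d)) (at_segment A \<alpha> g)"
      using d(1) by blast
  qed (rule pot)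
qed

lemma computable_on_transfer_segments:
  assumes tf: "computable_on D e tf" and inh: "computable_on D e inh" and g: "computable_on D e g"
    and m: "computable_on D e m"
    and ok: "\<And>z. z \<in> D \<Longrightarrow> \<exists>T A. realizes False (tf z) (fan T) \<and> realizes False (inh z) (inherited T A) \<and>
      (\<forall>s. realizes False (select (g z) s) (A (list_decode s)))"
    and path: "\<And>z. z \<in> D \<Longrightarrow> \<exists>T \<alpha>. realizes False (m z) (infinite_path T \<alpha>)"
  shows "computable_on D e (\<lambda>z. transfer_segments (tf z) (inh z) (g z) (m z))"
proof -
  have item: "computable_on D e (\<lambda>z. bind_code (\<lambda>s. sing (pair_code (sing s)
      (pair_code (untag 0 (untag 1 (d z))) (psnd (extend (tf z) (inh z) (g z) (list_decode s)))))) (untag 0 (d z)))"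
    if "computable_on D e tf" "computable_on D e inh" "computable_on D e g" "computable_on D e d"
      and ok: "\<And>z. z \<in> D \<Longrightarrow> \<exists>T A. realizes False (tf z) (fan T) \<and> realizes False (inh z) (inherited T A) \<and>
        (\<forall>s. realizes False (select (g z) s) (A (list_decode s)))"
    for D :: "'x set" and e tf inh g d
    by (intro computable_on_code_intros computable_on_extend computable_on_context_snd
        computable_on_weaken[OF that(1)] computable_on_weaken[OF that(2)] computable_on_weaken[OF that(3)]
        computable_on_weaken[OF that(4)] that(4)) (use ok in auto)
  show ?thesis
    unfolding transfer_segments_def
  proof (intro item computable_on_bind_code computable_on_ap computable_on_cons computable_on_const
      computable_on_context_snd m g computable_on_weaken[OF tf] computable_on_weaken[OF inh]
      computable_on_weaken[OF g])
    fix z assume "z \<in> D"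
    then obtain T \<alpha> where "realizes False (m z) (infinite_path T \<alpha>)" using path by blast
    then show "\<exists>p q. realizes False (m z) (p \<^bold>\<longrightarrow> q) \<and> realizes False (sing (g z)) p"
      unfolding infinite_path_def realizes_All_in_iff using realizes_sing_nat by blast
  qed (use ok in auto)
qed

text \<open>The uniform bound is the number \<open>w tf h\<close>, the code of the answer of
  \<open>h\<close> to the generic path realizers. It dominates every candidate in that answer and
  does not depend on the path.\<close>

lemma conclusion_realizer:
  "\<exists>c V. \<forall>G tf inh h T A. realizes G tf (fan T) \<longrightarrow> realizes G inh (inherited T A) \<longrightarrow>
    realizes G h (barred T A) \<longrightarrow> closure c (npair tf inh) \<bullet> h = Some (V tf inh h) \<and>
      realizes G (V tf inh h) (\<^bold>\<exists>n\<^bold>\<in>\<^bold>N. \<^bold>\<forall>\<alpha>\<^bold>\<in>exp_obj \<^bold>N \<^bold>N. infinite_path T \<alpha> \<^bold>\<longrightarrow> at_segment A \<alpha> n)"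
proof -
  obtain E where E: "computable_on UNIV (\<lambda>x. x) E"
    "\<And>G tf T f. realizes G tf (fan T) \<Longrightarrow> (\<And>n. G \<Longrightarrow> holds (T (segment f n))) \<Longrightarrow>
      realizes G (E tf) (exists_in (exp_obj \<^bold>N \<^bold>N) (graph f))"
    using exp_realizer by metis
  obtain P where P: "computable_on UNIV (\<lambda>x. x) P"
    "\<And>G tf T f. realizes G tf (fan T) \<Longrightarrow> (\<And>n. G \<Longrightarrow> holds (T (segment f n))) \<Longrightarrow>
      realizes G (P tf) (infinite_path T (graph f))"
    using path_realizer by metis
  define w where "w tf h = ap (ap h (E tf)) (P tf)" for tf h
  have bar: "realizes G h (exists_in (exp_obj \<^bold>N \<^bold>N) \<alpha> \<^bold>\<longrightarrow> infinite_path T \<alpha> \<^bold>\<longrightarrow> (\<^bold>\<exists>n\<^bold>\<in>\<^bold>N. at_segment A \<alpha> n))"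
    if "realizes G h (barred T A)" for G h T A \<alpha>
    using that unfolding realizes_All_in_iff[where X="exp_obj \<^bold>N \<^bold>N"] by blast
  \<comment> \<open>One and the same number realizes these statements for all functions
    \<open>f\<close>: the answer of \<open>h\<close> must contain a correct candidate for each path
    simultaneously.\<close>
  have w: "realizes G (w tf h) (\<^bold>\<exists>n\<^bold>\<in>\<^bold>N. at_segment A (graph f) n)"
    if "realizes G tf (fan T)" "realizes G h (barred T A)" "\<And>n. G \<Longrightarrow> holds (T (segment f n))" for G tf h T A f
    unfolding w_def
    by (rule realizes_ap[OF realizes_ap[OF bar[OF that(2)] E(2)[OF that(1,3)]] P(2)[OF that(1,3)]])
  \<comment> \<open>After weakening to potential realizability, the condition that \<open>f\<close>
    be a path is void and any function will do.\<close>
  have select: "realizes False (select (w tf h) s) (A (list_decode s))"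
    if "realizes G tf (fan T)" "realizes G h (barred T A)" for G tf h T A s
    using realizes_select(1)[OF w[OF realizes_False[OF that(1)] realizes_False[OF that(2)]]] by blast

  \<comment> \<open>The requirements on a single \<open>A\<close> by \<open>inh\<close> and
    \<open>select g\<close> together ensure that \<open>extend\<close> converges.\<close>
  define D where "D = {(tf, inh, g). \<exists>T A. realizes False tf (fan T) \<and> realizes False inh (inherited T A) \<and>
    (\<forall>s. realizes False (select g s) (A (list_decode s)))}"
  define Y where "Y = {m. \<exists>T \<alpha>. realizes False m (infinite_path T \<alpha>)}"
  let ?C = "{(z, m). z \<in> D \<and> m \<in> Y}" and ?e = "\<lambda>(tf, inh, g). npair tf (npair inh g)"
  have vars: "computable_on D ?e fst" "computable_on D ?e (\<lambda>z. fst (snd z))" "computable_on D ?e (\<lambda>z. snd (snd z))"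
    by (rule computable_on_cong[OF computable_on_pfst[OF computable_on_self]]
        computable_on_cong[OF computable_on_pfst[OF computable_on_psnd[OF computable_on_self]]]
        computable_on_cong[OF computable_on_psnd[OF computable_on_psnd[OF computable_on_self]]]; auto)+
  have "computable_on ?C (\<lambda>(z, m). npair (?e z) m)
      (\<lambda>p. transfer_segments (fst (fst p)) (fst (snd (fst p))) (snd (snd (fst p))) (snd p))"
    by (intro computable_on_transfer_segments computable_on_context_snd computable_on_weaken[OF vars(1)]
        computable_on_weaken[OF vars(2)] computable_on_weaken[OF vars(3)], auto simp: D_def Y_def) blast+
  from closure_exists[of D "\<lambda>_. Y" ?e "\<lambda>z m. transfer_segments (fst z) (fst (snd z)) (snd (snd z)) m", OF this]
  obtain b where b: "\<And>tf inh g m. (tf, inh, g) \<in> D \<Longrightarrow> m \<in> Y \<Longrightarrow>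
      closure b (npair tf (npair inh g)) \<bullet> m = Some (transfer_segments tf inh g m)"
    by fastforce
  have "computable_on UNIV (\<lambda>(x, y). npair x y) (\<lambda>p. sing (closure b (fst p)))"
    by (intro computable_on_code_intros computable_on_context_fst)
  from total_closure_exists[OF this]
  obtain a where a: "\<And>x y. closure a x \<bullet> y = Some (sing (closure b x))" by blast
  \<comment> \<open>A single candidate for \<open>n\<close> is enough, together with a closure that
    remembers \<open>tf\<close>, \<open>inh\<close> and the bound.\<close>
  define V where "V tf inh h = sing (pair_code (sing (w tf h)) (sing (closure a (npair tf (npair inh (w tf h))))))"
    for tf inh h

  have V: "realizes G (V tf inh h)
      (\<^bold>\<exists>n\<^bold>\<in>\<^bold>N. \<^bold>\<forall>\<alpha>\<^bold>\<in>exp_obj \<^bold>N \<^bold>N. infinite_path T \<alpha> \<^bold>\<longrightarrow> at_segment A \<alpha> n)"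
    if tf: "realizes G tf (fan T)" and inh: "realizes G inh (inherited T A)"
      and h: "realizes G h (barred T A)" for G tf inh h T A
  proof -
    let ?g = "w tf h"
    have D: "(tf, inh, ?g) \<in> D"
      unfolding D_def using realizes_False[OF tf] realizes_False[OF inh] select[OF tf h] by blast
    have "realizes G (sing (closure a (npair tf (npair inh ?g))))
        (\<^bold>\<forall>\<alpha>\<^bold>\<in>exp_obj \<^bold>N \<^bold>N. infinite_path T \<alpha> \<^bold>\<longrightarrow> at_segment A \<alpha> ?g)"
      unfolding realizes_All_in_iff
    proof (intro allI realizes_impI[OF a])
      fix \<alpha> H m assume HG: "H \<Longrightarrow> G" and m: "realizes H m (exists_in (exp_obj \<^bold>N \<^bold>N) \<alpha>)"
      show "realizes H (sing (closure b (npair tf (npair inh ?g)))) (infinite_path T \<alpha> \<^bold>\<longrightarrow> at_segment A \<alpha> ?g)"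
      proof (rule realizes_impI[OF b[OF D]])
        fix K k assume "realizes K k (infinite_path T \<alpha>)"
        then show "k \<in> Y" unfolding Y_def using realizes_False by blast
      next
        fix K k assume KH: "K \<Longrightarrow> H" and k: "realizes K k (infinite_path T \<alpha>)"
        show "realizes K (transfer_segments tf inh ?g k) (at_segment A \<alpha> ?g)"
        proof (rule realizes_transfer_segments[OF k])
          show "realizes False (psnd (extend tf inh ?g s)) (A s)" for s
            by (rule realizes_extend[OF tf inh select[OF tf h]])
          fix s assume K and s: "holds (is_initial_segment \<alpha> ?g s)"
          then have H G using KH HG by auto
          obtain f where f: "\<And>x y. holds (\<alpha> x y) \<Longrightarrow> f x = y" "\<And>n. holds (T (segment f n))"
            using classical_path[OF holds_if_realizes[OF m \<open>H\<close>] holds_if_realizes[OF k \<open>K\<close>]] by blast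
          \<comment> \<open>The bar is used at \<open>graph f\<close>, not at \<alpha>. The two
            share their initial segments, and \<open>A\<close> is a property of the segment alone,
            so the realizer obtained is equally good for \<alpha>.\<close>
          have "\<exists>n\<le>?g. realizes True (select ?g (list_encode (segment f n))) (A (segment f n))"
            by (rule realizes_select(2)[OF w[OF tf h f(2)] \<open>G\<close>]) (rule holds_graphD)
          then obtain n where "n \<le> ?g"
            "realizes True (select ?g (list_encode (segment f n))) (A (segment f n))"
            by blast
          moreover have "realizes True tf (fan T)" "realizes True inh (inherited T A)"
            using realizes_weaken[OF tf] realizes_weaken[OF inh] \<open>G\<close> by blast+
          ultimately have "realizes True (psnd (extend tf inh ?g (segment f ?g))) (A (segment f ?g))"
            using realizes_extend_segment[where f=f and T=T and A=A, OF _ _ select[OF tf h] f(2)] by blast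
          then show "realizes True (psnd (extend tf inh ?g s)) (A s)"
            using holds_initial_segmentD[OF s f(1)] by simp
        qed
      qed
    qed
    from realizes_pair_code[OF realizes_sing_nat this] show ?thesis
      unfolding V_def Ex_in_def by (rule realizes_ex_sing)
  qed

  define Y' where "Y' z = {h. \<exists>T A. realizes False (fst z) (fan T) \<and> realizes False (snd z) (inherited T A) \<and>
    realizes False h (barred T A)}" for z :: "nat \<times> nat"
  let ?C = "{(z, h). z \<in> UNIV \<and> h \<in> Y' z}"
  have E': "computable_on D e (\<lambda>z. E (f z))" "computable_on D e (\<lambda>z. P (f z))"
    if "computable_on D e f" for D :: "'x set" and e f
    using computable_on_comp[OF E(1) that] computable_on_comp[OF P(1) that] by simp_all
  have vars': "computable_on ?C (\<lambda>(z, h). npair ((\<lambda>(tf, inh). npair tf inh) z) h) (\<lambda>p. fst (fst p))"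
    "computable_on ?C (\<lambda>(z, h). npair ((\<lambda>(tf, inh). npair tf inh) z) h) (\<lambda>p. snd (fst p))"
    by (rule computable_on_weaken[OF computable_on_context_fst[of UNIV]]
        computable_on_weaken[OF computable_on_context_snd[of UNIV]]; simp)+
  have w': "computable_on ?C (\<lambda>(z, h). npair ((\<lambda>(tf, inh). npair tf inh) z) h) (\<lambda>p. w (fst (fst p)) (snd p))"
    unfolding w_def
  proof (intro computable_on_ap E' vars' computable_on_context_snd)
    fix p assume "p \<in> ?C"
    then obtain T A where tf: "realizes False (fst (fst p)) (fan T)" and h: "realizes False (snd p) (barred T A)"
      by (auto simp: Y'_def)
    \<comment> \<open>The zero function is a dummy: convergence needs only potential realizers, and
      those of \<open>E\<close> and \<open>P\<close> are available for any function.\<close>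
    note 1 = bar[OF h, of "graph (\<lambda>_. 0)"] E(2)[OF tf, of "\<lambda>_. 0"]
    show "\<exists>q r. realizes False (snd p) (q \<^bold>\<longrightarrow> r) \<and> realizes False (E (fst (fst p))) q"
      using 1 by blast
    show "\<exists>q r. realizes False (ap (snd p) (E (fst (fst p)))) (q \<^bold>\<longrightarrow> r) \<and> realizes False (P (fst (fst p))) q"
      using realizes_ap[OF 1(1) 1(2)] P(2)[OF tf, of "\<lambda>_. 0"] by blast
  qed
  have "computable_on ?C (\<lambda>(z, h). npair ((\<lambda>(tf, inh). npair tf inh) z) h) (\<lambda>p. V (fst (fst p)) (snd (fst p)) (snd p))"
    unfolding V_def by (intro computable_on_code_intros vars' w')
  from closure_exists[of UNIV Y' "\<lambda>(tf, inh). npair tf inh" "\<lambda>z h. V (fst z) (snd z) h", OF this]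
  obtain c where c: "\<And>tf inh h. h \<in> Y' (tf, inh) \<Longrightarrow> closure c (npair tf inh) \<bullet> h = Some (V tf inh h)"
    by fastforce
  show ?thesis
  proof (intro exI allI impI conjI)
    fix G tf inh h T A
    assume *: "realizes G tf (fan T)" "realizes G inh (inherited T A)" "realizes G h (barred T A)"
    from this[THEN realizes_False] have "h \<in> Y' (tf, inh)"
      unfolding Y'_def by simp blast
    then show "closure c (npair tf inh) \<bullet> h = Some (V tf inh h)"
      by (rule c)
    show "realizes G (V tf inh h) (\<^bold>\<exists>n\<^bold>\<in>\<^bold>N. \<^bold>\<forall>\<alpha>\<^bold>\<in>exp_obj \<^bold>N \<^bold>N. infinite_path T \<alpha> \<^bold>\<longrightarrow> at_segment A \<alpha> n)"
      by (rule V[OF *])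
  qed
qed

theorem proposition7p10:
  shows "holds
    (\<^bold>\<forall>T\<^bold>\<in>pow_obj \<^bold>S. tree T \<^bold>\<and> finitely_branching T \<^bold>\<longrightarrow>
      (\<^bold>\<forall>A\<^bold>\<in>pow_obj \<^bold>S. inherited T A \<^bold>\<longrightarrow>
        (\<^bold>\<forall>\<alpha>\<^bold>\<in>exp_obj \<^bold>N \<^bold>N. infinite_path T \<alpha> \<^bold>\<longrightarrow> (\<^bold>\<exists>n\<^bold>\<in>\<^bold>N. at_segment A \<alpha> n)) \<^bold>\<longrightarrow>
        (\<^bold>\<exists>n\<^bold>\<in>\<^bold>N. \<^bold>\<forall>\<alpha>\<^bold>\<in>exp_obj \<^bold>N \<^bold>N. infinite_path T \<alpha> \<^bold>\<longrightarrow> at_segment A \<alpha> n)))"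
proof -
  obtain c V where cV: "\<forall>G tf inh h T A. realizes G tf (fan T) \<longrightarrow> realizes G inh (inherited T A) \<longrightarrow>
    realizes G h (barred T A) \<longrightarrow> closure c (npair tf inh) \<bullet> h = Some (V tf inh h) \<and>
      realizes G (V tf inh h) (\<^bold>\<exists>n\<^bold>\<in>\<^bold>N. \<^bold>\<forall>\<alpha>\<^bold>\<in>exp_obj \<^bold>N \<^bold>N. infinite_path T \<alpha> \<^bold>\<longrightarrow> at_segment A \<alpha> n)"
    using conclusion_realizer by (elim exE)
  \<comment> \<open>The indices are built from the innermost implication outwards. In order of
    application, the antecedents are the existence of \<open>T\<close>, the tree conditions, the
    existence of \<open>A\<close>, inheritance and the bar; closures carry \<open>tf\<close> and
    then \<open>inh\<close> inwards.\<close>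
  have "computable_on UNIV (\<lambda>(x, y). npair x y) (\<lambda>p. sing (closure c (npair (fst p) (snd p))))"
    by (intro computable_on_code_intros computable_on_context_fst computable_on_context_snd)
  from total_closure_exists[OF this]
  obtain r4 where r4: "\<And>tf inh. closure r4 tf \<bullet> inh = Some (sing (closure c (npair tf inh)))" by blast
  have "computable_on UNIV (\<lambda>(x, y). npair x y) (\<lambda>p. sing (closure r4 (fst p)))"
    by (intro computable_on_code_intros computable_on_context_fst)
  from total_closure_exists[OF this]
  obtain r3 where r3: "\<And>tf m. closure r3 tf \<bullet> m = Some (sing (closure r4 tf))" by blast
  have "computable_on UNIV (\<lambda>x. x) (\<lambda>tf. sing (closure r3 tf))"
    by (intro computable_on_code_intros computable_on_self)
  from total_index_exists[OF this]
  obtain r2 where r2: "\<And>tf. r2 \<bullet> tf = Some (sing (closure r3 tf))" by blast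
  obtain r1 where r1: "\<And>m. r1 \<bullet> m = Some (sing r2)"
    using total_index_exists[OF computable_on_const] by blast
  have "realizes True (sing r1) (\<^bold>\<forall>T\<^bold>\<in>pow_obj \<^bold>S. fan T \<^bold>\<longrightarrow> (\<^bold>\<forall>A\<^bold>\<in>pow_obj \<^bold>S. inherited T A \<^bold>\<longrightarrow> barred T A \<^bold>\<longrightarrow>
      (\<^bold>\<exists>n\<^bold>\<in>\<^bold>N. \<^bold>\<forall>\<alpha>\<^bold>\<in>exp_obj \<^bold>N \<^bold>N. infinite_path T \<alpha> \<^bold>\<longrightarrow> at_segment A \<alpha> n)))"
    unfolding realizes_All_in_iff[where X="pow_obj \<^bold>S"]
  proof (intro allI, rule realizes_impI[OF r1], rule realizes_impI[OF r2],
      unfold realizes_All_in_iff[where X="pow_obj \<^bold>S"], intro allI, rule realizes_impI[OF r3], rule realizes_impI[OF r4])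
    fix T A G tf H m K inh
    assume tf: "realizes G tf (fan T)" and H: "H \<Longrightarrow> G" and K: "K \<Longrightarrow> H"
      and inh: "realizes K inh (inherited T A)"
    show "realizes K (sing (closure c (npair tf inh))) (barred T A \<^bold>\<longrightarrow>
        (\<^bold>\<exists>n\<^bold>\<in>\<^bold>N. \<^bold>\<forall>\<alpha>\<^bold>\<in>exp_obj \<^bold>N \<^bold>N. infinite_path T \<alpha> \<^bold>\<longrightarrow> at_segment A \<alpha> n))"
    proof (rule realizes_impI)
      fix L h assume L: "L \<Longrightarrow> K" and h: "realizes L h (barred T A)"
      have "realizes L tf (fan T)" "realizes L inh (inherited T A)"
        using realizes_weaken[OF tf] realizes_weaken[OF inh] H K L by blast+
      with h cV show "closure c (npair tf inh) \<bullet> h = Some (V tf inh h)"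
        "realizes L (V tf inh h) (\<^bold>\<exists>n\<^bold>\<in>\<^bold>N. \<^bold>\<forall>\<alpha>\<^bold>\<in>exp_obj \<^bold>N \<^bold>N. infinite_path T \<alpha> \<^bold>\<longrightarrow> at_segment A \<alpha> n)"
        by blast+
    qed
  qed
  then show ?thesis
    by (auto simp: holds_iff)
qed

end
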